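(* Fix a vertex $v\in V$ and observed data $(x,y)$, and consider the birth-death Markov process on the finite space $\mathcal{N}_v$ of neighbourhood models of $v$ in the dynamic Ising model, as defined in the context. Suppose that for every $N_v\in\mathcal{N}_v$ and every variable $u\notin N_v$, writing $N'_v=N_v\cup u$, the birth rate of $u$ at $N_v$ (the rate of the jump $N_v\to N'_v$) and the death rate of $u$ at $N'_v$ (the rate of the jump $N'_v\to N_v$) are $$B_u(N_v,N'_v)=\min\left(\frac{p(N'_v\mid y,x)}{p(N_v\mid y,x)},\,1\right),\qquad D_u(N'_v,N_v)=\min\left(\frac{p(N_v\mid y,x)}{p(N'_v\mid y,x)},\,1\right).$$ Then the stationary distribution of this birth-death process is the posterior distribution $\{p(N_v\mid y,x): N_v\in\mathcal{N}_v\}$.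
   Context: **Dynamic Ising model.** Let $V$ be a finite vertex set, $|V|=p$, and $H\ge1$. Given covariates $x=(x^1,\dots,x^H)$, with $x^0=1$, and graphs $G_h=(V,E_h)$, $h=0,\dots,H$ (baseline graph for $h=0$, slope graphs for $h\geq 1$), the binary vector $\boldsymbol{Y}=(Y_v)_{v\in V}\in\{0,1\}^V$ has probability mass function proportional to $\exp\{\sum_{h=0}^H\sum_{v\in V}\theta_{v,h}x^hy_v+\sum_{h=0}^H\sum_{(u,v)\in E_h}\theta_{uv,h}x^hy_uy_v\}$. **Neighbourhood models.** For a fixed vertex $v$, let $U_v^h=\{u:(u,v)\in E_h\}$, $h=0,\dots,H$. A neighbourhood model of $v$ is $N_v=\{U_v^h,\ h=0,\dots,H\}$. It is identified with a subset of the finite set of candidate variables $(V\setminus\{v\})\times\{0,\dots,H\}$, where the pair $(w,h)$ belongs to $N_v$ iff $w\in U_v^h$. A "variable $u$" that is added to or removed from $N_v$ means such a candidate, and $N_v\cup u$, $N_v\setminus u$ mean adding or removing it. $\mathcal{N}_v$ is the set of all neighbourhood models of $v$. **Conditional likelihood.** Given $N_v$, let $\boldsymbol{\theta}^v=(\theta_{v,h},\theta_{uv,h}: u\in U_v^h,\ h=0,\dots,H)$ be the parameters involving $v$. The data $(x,y)$ consist of $n$ observations $y_{(m)}\in\{0,1\}^V$ with covariates $x_m$ ($x_m^0=1$), $m=1,\dots,n$. The conditional likelihood of the observations of variable $v$ given the other variables is $$p(y_v\mid y_{N_v},x,\boldsymbol{\theta}^v)=\prod_{m=1}^n\frac{\exp\{y_{(m),v}\,\eta_m\}}{1+\exp\{\eta_m\}},\qquad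 \eta_m=\sum_{h=0}^H\Big(\theta_{v,h}x_m^h+\sum_{u\in U_v^h}\theta_{uv,h}x_m^hy_{(m),u}\Big).$$ **Posterior.** Let $\pi$ be a prior probability distribution on $\mathcal{N}_v$ with $\pi(N_v)>0$ for every $N_v$. For each $N_v$ let $p(\boldsymbol{\theta}^v\mid N_v)$ be a prior probability distribution for $\boldsymbol{\theta}^v$. Put $p(y_v\mid y_{N_v},x)=\int p(y_v\mid y_{N_v},x,\boldsymbol{\theta}^v)\,p(\boldsymbol{\theta}^v\mid N_v)\,d\boldsymbol{\theta}^v$. The posterior distribution on $\mathcal{N}_v$ is the probability distribution $$p(N_v\mid y,x)\propto p(y_v\mid y_{N_v},x)\,\pi(N_v).$$ **Birth-death process.** This is the continuous-time Markov jump process on $\mathcal{N}_v$ in which, when the current state is $N_v$, independently of each other: each variable $u\notin N_v$ is born according to a Poisson process with rate $B_u(N_v)$ (also written $B_u(N_v,N_v\cup u)$), in which case the process jumps to $N_v\cup u$; and each variable $u'\in N_v$ dies according to a Poisson process with rate $D_{u'}(N_v)$ (also written $D_{u'}(N_v,N_v\setminus u')$), in which case the process jumps to $N_v\setminus u'$. Thus the holding time in $N_v$ is exponential with mean $1/R(N_v)$, where $R(N_v)=\sum_{u\notin N_v}B_u(N_v)+\sum_{u'\in N_v}D_{u'}(N_v)$. The next jump is to $N_v\cup u$ with probability $B_u(N_v)/R(N_v)$ and to $N_v\setminus u'$ with probability $D_{u'}(N_v)/R(N_v)$. *)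

theory Defs
  imports "HOL-Probability.Probability"
begin

section \<open>Neighbourhood models of a vertex\<close>

definition candidates :: "'v set \<Rightarrow> nat \<Rightarrow> 'v \<Rightarrow> ('v \<times> nat) set" where
  "candidates V H v = (V - {v}) \<times> {0..H}"

text \<open>A model is the set of pairs \<open>(u, h)\<close> such that \<open>u\<close> is a neighbour of \<open>v\<close> in the graph
  \<open>G\<^sub>h\<close>; every family of neighbourhoods \<open>(U\<^sub>h)\<close> arises in this way.\<close>

definition models :: "'v set \<Rightarrow> nat \<Rightarrow> 'v \<Rightarrow> ('v \<times> nat) set set" where
  "models V H v = Pow (candidates V H v)"

definition nbrs :: "('v \<times> nat) set \<Rightarrow> nat \<Rightarrow> 'v set" where
  "nbrs N h = {u. (u, h) \<in> N}"


section \<open>Conditional likelihood and posterior\<close>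

text \<open>Names of the parameters that involve the fixed vertex \<open>v\<close>: \<open>Node h\<close> stands for
  \<open>\<theta>\<close> with index \<open>(v, h)\<close> and \<open>Edge u h\<close> for \<open>\<theta>\<close> with index \<open>(uv, h)\<close>.\<close>

datatype 'v param = Node nat | Edge 'v nat

definition params :: "nat \<Rightarrow> ('v \<times> nat) set \<Rightarrow> 'v param set" where
  "params H N = {Node h | h. h \<in> {0..H}} \<union> {Edge u h | u h. h \<in> {0..H} \<and> u \<in> nbrs N h}"

definition predictor ::
  "nat \<Rightarrow> (nat \<Rightarrow> real) \<Rightarrow> ('v \<Rightarrow> bool) \<Rightarrow> ('v \<times> nat) set \<Rightarrow> ('v param \<Rightarrow> real) \<Rightarrow> real" where
  "predictor H x y N \<theta> =
     (\<Sum>h=0..H. \<theta> (Node h) * x h + (\<Sum>u\<in>nbrs N h. \<theta> (Edge u h) * x h * of_bool (y u)))"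

text \<open>Observation \<open>m \<in> {1..n}\<close> consists of the covariates \<open>x m\<close> and the binary vector \<open>y m\<close>,
  with \<open>True\<close> encoding the value 1.\<close>

definition cond_likelihood ::
  "nat \<Rightarrow> 'v \<Rightarrow> nat \<Rightarrow> (nat \<Rightarrow> nat \<Rightarrow> real) \<Rightarrow> (nat \<Rightarrow> 'v \<Rightarrow> bool) \<Rightarrow> ('v \<times> nat) set
     \<Rightarrow> ('v param \<Rightarrow> real) \<Rightarrow> real" where
  "cond_likelihood H v n x y N \<theta> =
     (\<Prod>m=1..n. exp (of_bool (y m v) * predictor H (x m) (y m) N \<theta>)
                  / (1 + exp (predictor H (x m) (y m) N \<theta>)))"

definition param_prior ::
  "nat \<Rightarrow> ('v \<times> nat) set \<Rightarrow> ('v param \<Rightarrow> real) measure \<Rightarrow> bool" where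
  "param_prior H N \<rho> \<longleftrightarrow>
     prob_space \<rho> \<and> sets \<rho> = sets (PiM (params H N) (\<lambda>_. borel :: real measure))"

definition marginal_likelihood ::
  "nat \<Rightarrow> 'v \<Rightarrow> nat \<Rightarrow> (nat \<Rightarrow> nat \<Rightarrow> real) \<Rightarrow> (nat \<Rightarrow> 'v \<Rightarrow> bool)
     \<Rightarrow> (('v \<times> nat) set \<Rightarrow> ('v param \<Rightarrow> real) measure) \<Rightarrow> ('v \<times> nat) set \<Rightarrow> real" where
  "marginal_likelihood H v n x y \<rho> N = (LINT \<theta>|\<rho> N. cond_likelihood H v n x y N \<theta>)"

definition posterior ::
  "'v set \<Rightarrow> nat \<Rightarrow> 'v \<Rightarrow> nat \<Rightarrow> (nat \<Rightarrow> nat \<Rightarrow> real) \<Rightarrow> (nat \<Rightarrow> 'v \<Rightarrow> bool)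
     \<Rightarrow> (('v \<times> nat) set \<Rightarrow> ('v param \<Rightarrow> real) measure) \<Rightarrow> ('v \<times> nat) set pmf
     \<Rightarrow> ('v \<times> nat) set \<Rightarrow> real" where
  "posterior V H v n x y \<rho> \<pi> N =
     marginal_likelihood H v n x y \<rho> N * pmf \<pi> N
     / (\<Sum>N'\<in>models V H v. marginal_likelihood H v n x y \<rho> N' * pmf \<pi> N')"


section \<open>Birth-death processes on the subsets of a finite set\<close>

text \<open>In what follows \<open>C\<close> is the set of candidates, \<open>B u N\<close> is the rate of the jump from \<open>N\<close> to
  \<open>insert u N\<close> for \<open>u \<in> C - N\<close>, and \<open>D u N\<close> is the rate of the jump from \<open>N\<close> to \<open>N - {u}\<close> for
  \<open>u \<in> N\<close>.\<close>

definition total_rate ::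
  "'c set \<Rightarrow> ('c \<Rightarrow> 'c set \<Rightarrow> real) \<Rightarrow> ('c \<Rightarrow> 'c set \<Rightarrow> real) \<Rightarrow> 'c set \<Rightarrow> real" where
  "total_rate C B D N = (\<Sum>u\<in>C - N. B u N) + (\<Sum>u\<in>N. D u N)"

text \<open>If the total rate vanishes then the state is absorbing (holding time \<open>\<infinity>\<close>), and the embedded
  chain stays there by convention. This happens if there are no candidates at all.\<close>

definition jump_prob ::
  "'c set \<Rightarrow> ('c \<Rightarrow> 'c set \<Rightarrow> real) \<Rightarrow> ('c \<Rightarrow> 'c set \<Rightarrow> real) \<Rightarrow> 'c set \<Rightarrow> 'c set \<Rightarrow> real" where
  "jump_prob C B D N N' =
     (if total_rate C B D N = 0 then of_bool (N' = N)
      else ((\<Sum>u | u \<in> C - N \<and> N' = insert u N. B u N) + (\<Sum>u | u \<in> N \<and> N' = N - {u}. D u N))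
           / total_rate C B D N)"

text \<open>The law of a jump process with initial state \<open>N0\<close>, in terms of the sequence \<open>Z\<close> of visited
  states and the sequence \<open>S\<close> of holding times: \<open>Z\<close> is a Markov chain with transition
  probabilities \<open>jump_prob\<close>, and conditionally on \<open>Z\<close> the holding times are independent, that of
  \<open>Z i\<close> being exponential with rate \<open>total_rate (Z i)\<close>.\<close>

definition jump_hold ::
  "'c set \<Rightarrow> ('c \<Rightarrow> 'c set \<Rightarrow> real) \<Rightarrow> ('c \<Rightarrow> 'c set \<Rightarrow> real) \<Rightarrow> 'c set \<Rightarrow> 'w measure
     \<Rightarrow> (nat \<Rightarrow> 'w \<Rightarrow> 'c set) \<Rightarrow> (nat \<Rightarrow> 'w \<Rightarrow> ennreal) \<Rightarrow> bool" where
  "jump_hold C B D N0 M Z S \<longleftrightarrow>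
     (\<forall>i. Z i \<in> M \<rightarrow>\<^sub>M count_space (Pow C)) \<and>
     (\<forall>i. S i \<in> borel_measurable M) \<and>
     (\<forall>n z s. (\<forall>i\<le>n. z i \<in> Pow C \<and> 0 \<le> s i) \<longrightarrow>
        measure M {\<omega> \<in> space M. \<forall>i\<le>n. Z i \<omega> = z i \<and> ennreal (s i) < S i \<omega>} =
          of_bool (z 0 = N0) * (\<Prod>i<n. jump_prob C B D (z i) (z (Suc i)))
          * (\<Prod>i\<le>n. exp (- total_rate C B D (z i) * s i)))"

text \<open>\<open>X t\<close> is the state at time \<open>t\<close>: it equals \<open>Z k\<close> from the \<open>k\<close>-th jump time up to, but
  excluding, the next one.\<close>

definition birth_death_process ::
  "'c set \<Rightarrow> ('c \<Rightarrow> 'c set \<Rightarrow> real) \<Rightarrow> ('c \<Rightarrow> 'c set \<Rightarrow> real) \<Rightarrow> 'c set \<Rightarrow> 'w measure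
     \<Rightarrow> (real \<Rightarrow> 'w \<Rightarrow> 'c set) \<Rightarrow> bool" where
  "birth_death_process C B D N0 M X \<longleftrightarrow>
     prob_space M \<and>
     (\<forall>t\<ge>0. X t \<in> M \<rightarrow>\<^sub>M count_space (Pow C)) \<and>
     (\<exists>Z S. jump_hold C B D N0 M Z S \<and>
        (AE \<omega> in M. \<forall>t\<ge>0. \<forall>k. (\<Sum>i<k. S i \<omega>) \<le> ennreal t \<and> ennreal t < (\<Sum>i\<le>k. S i \<omega>)
                       \<longrightarrow> X t \<omega> = Z k \<omega>))"

text \<open>\<open>P N\<close> is the probability measure under which the process \<open>X\<close> starts in \<open>N\<close>.\<close>

definition trans_prob ::
  "('s \<Rightarrow> 'w measure) \<Rightarrow> (real \<Rightarrow> 'w \<Rightarrow> 's) \<Rightarrow> real \<Rightarrow> 's \<Rightarrow> 's \<Rightarrow> real" where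
  "trans_prob P X t N N' = measure (P N) {\<omega> \<in> space (P N). X t \<omega> = N'}"

definition stationary_distribution ::
  "'s set \<Rightarrow> ('s \<Rightarrow> 'w measure) \<Rightarrow> (real \<Rightarrow> 'w \<Rightarrow> 's) \<Rightarrow> ('s \<Rightarrow> real) \<Rightarrow> bool" where
  "stationary_distribution \<Omega> P X \<mu> \<longleftrightarrow>
     (\<forall>N\<in>\<Omega>. 0 \<le> \<mu> N) \<and> (\<Sum>N\<in>\<Omega>. \<mu> N) = 1 \<and>
     (\<forall>t\<ge>0. \<forall>N'\<in>\<Omega>. (\<Sum>N\<in>\<Omega>. \<mu> N * trans_prob P X t N N') = \<mu> N')"

end

theory Submission
  imports Defs
begin

text \<open>The process is reversible path by path. Conditionally on the visited states, the holding
  times are independent exponentials, and for two independent exponentials \<open>S\<close>, \<open>S'\<close> of rates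
  \<open>r\<close>, \<open>r'\<close> the number \<open>r' P(S \<le> c < S + S')\<close> is symmetric in \<open>r\<close>, \<open>r'\<close>. Applied to the first and
  the last holding time, this shows that a path and its reversal are equally likely up to time \<open>t\<close>,
  apart from a factor that detailed balance turns into the ratio of the weights \<open>w\<close> of the end
  points. Summing over paths, which is legitimate because the process does not explode, gives
  \<open>w a * p\<^sub>t a b = w b * p\<^sub>t b a\<close> without any differential equation, hence stationarity. Conversely, the
  ratio of a stationary distribution to \<open>w\<close> is harmonic for \<open>p\<^sub>1\<close>, so it is constant by the maximum
  principle, because neighbouring states communicate.\<close>

section \<open>Independent exponential holding times\<close>

abbreviation expm :: "real \<Rightarrow> real measure" where
  "expm r \<equiv> density lborel (exponential_density r)"

lemma emeasure_expm_greaterThan: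
  assumes "0 < r" "0 \<le> a"
  shows "emeasure (expm r) {a<..} = ennreal (exp (- r * a))"
proof -
  interpret prob_space "expm r" using assms by (intro prob_space_exponential_density)
  have "distributed (expm r) lborel (\<lambda>x. x) (exponential_density r)"
    unfolding distributed_def by (simp add: distr_id2)
  from exponential_distributedD_gt[OF this assms(2,1)]
  have "measure (expm r) {a<..} = exp (- a * r)"
    by (simp add: greaterThan_def)
  then show ?thesis by (simp add: emeasure_eq_measure mult.commute)
qed

text \<open>Upper half-lines form an intersection-stable generator of the Borel sets, so joint
  survival probabilities determine the joint law; their product form gives independence with
  exponential marginals. The times live in \<open>ennreal\<close>, so almost sure finiteness has to
  come first: only then does \<open>enn2real\<close> lose nothing.\<close>

lemma joint_exponential_law:
  fixes S :: "nat \<Rightarrow> 'w \<Rightarrow> ennreal"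
  assumes M: "prob_space M" and S[measurable]: "\<And>i. S i \<in> borel_measurable M"
    and r: "\<And>i. i \<le> k \<Longrightarrow> 0 < r i"
    and surv: "\<And>s. (\<And>i. i \<le> k \<Longrightarrow> 0 \<le> s i) \<Longrightarrow>
      measure M {\<omega> \<in> space M. \<forall>i\<le>k. ennreal (s i) < S i \<omega>} = (\<Prod>i\<le>k. exp (- r i * s i))"
  shows "AE \<omega> in M. \<forall>i\<le>k. S i \<omega> < \<infinity>"
    and "distr M (PiM {..k} (\<lambda>_. borel)) (\<lambda>\<omega>. \<lambda>i\<in>{..k}. enn2real (S i \<omega>))
           = PiM {..k} (\<lambda>i. expm (r i))"
proof -
  interpret prob_space M by fact
  define R where "R i \<omega> = enn2real (S i \<omega>)" for i \<omega>
  have R[measurable]: "R i \<in> borel_measurable M" for i unfolding R_def by measurable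
  have pos: "AE \<omega> in M. \<forall>i\<le>k. 0 < S i \<omega>"
  proof -
    have "prob {\<omega> \<in> space M. \<forall>i\<le>k. 0 < S i \<omega>} = 1" using surv[of "\<lambda>_. 0"] by simp
    then show ?thesis by (subst (asm) prob_Collect_eq_1) auto
  qed
  \<comment> \<open>Setting all other thresholds to 0 isolates one coordinate, since all times are
    almost surely positive.\<close>
  have marg: "prob {\<omega> \<in> space M. ennreal s < S j \<omega>} = exp (- r j * s)" if "j \<le> k" "0 \<le> s" for j s
  proof -
    have "prob {\<omega> \<in> space M. ennreal s < S j \<omega>}
      = prob {\<omega> \<in> space M. \<forall>i\<le>k. ennreal (if i = j then s else 0) < S i \<omega>}"
      by (rule finite_measure_eq_AE) (use pos that in \<open>auto elim!: AE_mp\<close>)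
    also have "\<dots> = (\<Prod>i\<le>k. exp (- r i * (if i = j then s else 0)))"
      using that by (intro surv) auto
    also have "\<dots> = (\<Prod>i\<le>k. (if i = j then exp (- r j * s) else 1))"
      by (intro prod.cong) auto
    also have "\<dots> = exp (- r j * s)" using that by simp
    finally show ?thesis .
  qed
  have fin1: "AE \<omega> in M. S j \<omega> < \<infinity>" if "j \<le> k" for j
  proof -
    \<comment> \<open>An infinite time exceeds every \<open>n\<close>, and the probability of
      exceeding \<open>n\<close> tends to 0.\<close>
    have "prob {\<omega> \<in> space M. S j \<omega> = \<infinity>} \<le> exp (- r j * real n)" for n :: nat
    proof -
      have "prob {\<omega> \<in> space M. S j \<omega> = \<infinity>} \<le> prob {\<omega> \<in> space M. ennreal (real n) < S j \<omega>}"
        by (rule finite_measure_mono) auto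
      then show ?thesis using marg[OF that, of "real n"] by simp
    qed
    moreover have "(\<lambda>n. exp (- r j * real n)) \<longlonglongrightarrow> 0"
      using r[OF that] by real_asymp
    ultimately have "prob {\<omega> \<in> space M. S j \<omega> = \<infinity>} \<le> 0"
      by (intro LIMSEQ_le_const) auto
    then have "prob {\<omega> \<in> space M. S j \<omega> = \<infinity>} = 0"
      by (simp add: measure_le_0_iff)
    then have "AE \<omega> in M. \<not> (S j \<omega> = \<infinity>)"
      by (subst (asm) prob_Collect_eq_0) auto
    then show ?thesis by (rule AE_mp) (auto simp: less_top)
  qed
  show fin: "AE \<omega> in M. \<forall>i\<le>k. S i \<omega> < \<infinity>"
    using fin1 by (subst AE_all_countable) (auto intro: AE_impI)
  have RS: "AE \<omega> in M. \<forall>i\<le>k. 0 < R i \<omega> \<and> (\<forall>s\<ge>0. s < R i \<omega> \<longleftrightarrow> ennreal s < S i \<omega>)"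
    using fin pos
  proof eventually_elim
    case (elim \<omega>)
    show ?case
    proof (intro allI impI)
      fix i assume i: "i \<le> k"
      with elim obtain x where x: "S i \<omega> = ennreal x" "0 \<le> x"
        by (metis ennreal_cases infinity_ennreal_def order_less_irrefl)
      with elim i have "0 < x" by auto
      with x show "0 < R i \<omega> \<and> (\<forall>s\<ge>0. s < R i \<omega> \<longleftrightarrow> ennreal s < S i \<omega>)"
        by (auto simp: R_def ennreal_less_iff)
    qed
  qed
  have Rjoint: "prob {\<omega> \<in> space M. \<forall>i\<le>k. s i < R i \<omega>} = (\<Prod>i\<le>k. exp (- r i * s i))"
    if s: "\<And>i. i \<le> k \<Longrightarrow> 0 \<le> s i" for s
  proof -
    have "prob {\<omega> \<in> space M. \<forall>i\<le>k. s i < R i \<omega>} = prob {\<omega> \<in> space M. \<forall>i\<le>k. ennreal (s i) < S i \<omega>}"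
      by (rule finite_measure_eq_AE) (use RS s in \<open>auto elim!: AE_mp\<close>)
    then show ?thesis using surv[OF s] by simp
  qed
  have Rmarg: "prob {\<omega> \<in> space M. s < R j \<omega>} = exp (- r j * s)" if "j \<le> k" "0 \<le> s" for s j
  proof -
    have "prob {\<omega> \<in> space M. s < R j \<omega>} = prob {\<omega> \<in> space M. ennreal s < S j \<omega>}"
      by (rule finite_measure_eq_AE) (use RS that in \<open>auto elim!: AE_mp\<close>)
    then show ?thesis using marg[OF that] by simp
  qed
  \<comment> \<open>The independence criterion asks for a generator that contains the whole space;
    half-lines alone do not, hence the extra \<open>UNIV\<close>.\<close>
  let ?E = "insert UNIV (range (\<lambda>a::real. {a<..}))"
  have ind: "indep_vars (\<lambda>_. borel) R {..k}"
  proof (subst indep_vars_finite[where E = "\<lambda>_. ?E"], goal_cases)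
    case (3 i)
    show ?case
    proof
      show "sets borel \<subseteq> sigma_sets (space borel) ?E"
      proof -
        have "sets (borel :: real measure) = sigma_sets UNIV (range (\<lambda>a. {a<..}))"
          by (subst borel_Ioi) simp
        then show ?thesis by (simp add: sigma_sets_mono' subset_insertI)
      qed
      show "sigma_sets (space borel) ?E \<subseteq> sets borel"
        by (rule sets.sigma_sets_subset') auto
    qed
  next
    case (5 i)
    have "{a<..} \<inter> {b<..} = {max a b<..}" for a b :: real by auto
    then show ?case by (auto simp: Int_stable_def)
  next
    case 8
    show ?case
    proof
      fix A assume A: "A \<in> (\<Pi> i\<in>{..k}. ?E)"
      \<comment> \<open>The survival formula covers nonnegative thresholds only. Since
        \<open>R i\<close> is almost surely positive, both \<open>UNIV\<close> and a half-line with
        negative end point amount to threshold 0.\<close>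
      define s where "s i = (if A i = UNIV then 0 else max 0 (SOME a. A i = {a<..}))" for i
      have s0: "0 \<le> s i" for i by (auto simp: s_def)
      have AE1: "AE \<omega> in M. \<forall>i\<le>k. R i \<omega> \<in> A i \<longleftrightarrow> s i < R i \<omega>"
        using RS
      proof eventually_elim
        case (elim \<omega>)
        show ?case
        proof (intro allI impI)
          fix i assume i: "i \<le> k"
          show "R i \<omega> \<in> A i \<longleftrightarrow> s i < R i \<omega>"
          proof (cases "A i = UNIV")
            case True
            then show ?thesis using elim i by (auto simp: s_def)
          next
            case False
            with A i have "\<exists>a. A i = {a<..}" by (auto simp: Pi_iff)
            then have "A i = {(SOME a. A i = {a<..})<..}" by (rule someI_ex)
            moreover have "s i = max 0 (SOME a. A i = {a<..})" using False by (simp add: s_def)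
            ultimately show ?thesis using elim i by (metis greaterThan_iff max_less_iff_conj)
          qed
        qed
      qed
      have [measurable]: "A j \<in> sets borel" if "j \<le> k" for j
      proof -
        have "A j = UNIV \<or> A j \<in> range (\<lambda>a. {a<..})" using A that by (auto simp: Pi_iff)
        then show ?thesis by (elim disjE rangeE) simp_all
      qed
      have "prob (\<Inter>j\<in>{..k}. R j -` A j \<inter> space M) = prob {\<omega> \<in> space M. \<forall>i\<le>k. s i < R i \<omega>}"
      proof (rule finite_measure_eq_AE)
        show "AE \<omega> in M. (\<omega> \<in> (\<Inter>j\<in>{..k}. R j -` A j \<inter> space M))
            \<longleftrightarrow> (\<omega> \<in> {\<omega> \<in> space M. \<forall>i\<le>k. s i < R i \<omega>})"
          using AE1 AE_space by eventually_elim auto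
        show "(\<Inter>j\<in>{..k}. R j -` A j \<inter> space M) \<in> events"
          by (intro sets.finite_INT measurable_sets[OF R]) auto
      qed auto
      also have "\<dots> = (\<Prod>i\<le>k. exp (- r i * s i))" by (rule Rjoint) (rule s0)
      also have "\<dots> = (\<Prod>j\<in>{..k}. prob (R j -` A j \<inter> space M))"
      proof (rule prod.cong)
        fix j assume j: "j \<in> {..k}"
        have "prob (R j -` A j \<inter> space M) = prob {\<omega> \<in> space M. s j < R j \<omega>}"
        proof (rule finite_measure_eq_AE)
          show "AE \<omega> in M. (\<omega> \<in> R j -` A j \<inter> space M) \<longleftrightarrow> (\<omega> \<in> {\<omega> \<in> space M. s j < R j \<omega>})"
            using AE1 AE_space by eventually_elim (use j in auto)
        qed (use j in \<open>auto intro!: measurable_sets[OF R]\<close>)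
        then show "exp (- r j * s j) = prob (R j -` A j \<inter> space M)"
          using Rmarg[of j "s j"] s0 j by simp
      qed simp
      finally show "prob (\<Inter>j\<in>{..k}. R j -` A j \<inter> space M) = (\<Prod>j\<in>{..k}. prob (R j -` A j \<inter> space M))" .
    qed
  qed auto
  have Rdistr: "distr M borel (R j) = expm (r j)" if j: "j \<le> k" for j
  proof -
    have "distributed M lborel (R j) (exponential_density (r j))"
    proof (rule exponential_distributedI)
      fix a :: real assume a: "0 \<le> a"
      have "prob {x \<in> space M. R j x \<le> a} = prob (space M - {x \<in> space M. a < R j x})"
        by (intro arg_cong[where f = prob]) auto
      also have "\<dots> = 1 - exp (- a * r j)"
        by (subst prob_compl) (use Rmarg[OF j a] in \<open>auto simp: mult.commute\<close>)
      finally show "emeasure M {x \<in> space M. R j x \<le> a} = 1 - ennreal (exp (- a * r j))"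
        by (simp add: emeasure_eq_measure ennreal_minus flip: ennreal_1)
    qed (use r[OF j] in auto)
    then have "distr M lborel (R j) = expm (r j)" by (simp add: distributed_def)
    moreover have "distr M borel (R j) = distr M lborel (R j)" by (intro distr_cong) auto
    ultimately show ?thesis by simp
  qed
  \<comment> \<open>Independence is the same as the joint law being the product of the marginals,
    which \<open>Rdistr\<close> identifies.\<close>
  have "distr M (PiM {..k} (\<lambda>_. borel)) (\<lambda>\<omega>. \<lambda>i\<in>{..k}. R i \<omega>)
      = PiM {..k} (\<lambda>i. distr M borel (R i))"
    using iffD1[OF indep_vars_iff_distr_eq_PiM[OF _ R] ind] by simp
  also have "\<dots> = PiM {..k} (\<lambda>i. expm (r i))"
    by (intro PiM_cong) (auto simp: Rdistr)
  finally show "distr M (PiM {..k} (\<lambda>_. borel)) (\<lambda>\<omega>. \<lambda>i\<in>{..k}. enn2real (S i \<omega>))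
           = PiM {..k} (\<lambda>i. expm (r i))" by (simp add: R_def)
qed

section \<open>Exponential times straddling a fixed level, and reversal of their order\<close>

lemma nn_integral_expm:
  assumes [measurable]: "f \<in> borel_measurable borel"
  shows "(\<integral>\<^sup>+x. f x \<partial>expm r) = (\<integral>\<^sup>+x. ennreal (exponential_density r x) * f x \<partial>lborel)"
  by (subst nn_integral_density) auto

lemma emeasure_expm_crossing:
  assumes "0 < q"
  shows "emeasure (expm q) {y. x \<le> c \<and> c < x + y} = ennreal (if x \<le> c then exp (- q * (c - x)) else 0)"
proof (cases "x \<le> c")
  case True
  then have "{y. x \<le> c \<and> c < x + y} = {c - x<..}" by auto
  then show ?thesis using emeasure_expm_greaterThan[OF assms, of "c - x"] True by simp
qed simp

text \<open>Each side is the integral over \<open>0 <= x <= c\<close> of \<open>r * q\<close> times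
  \<open>exp (- r * x) * exp (- q * (c - x))\<close>, up to exchanging \<open>r\<close> and
  \<open>q\<close>; the substitution of \<open>c - x\<close> for \<open>x\<close> performs the
  exchange.\<close>

lemma two_exponentials_swap:
  assumes r: "0 < r" and q: "0 < q"
  shows "ennreal q * (\<integral>\<^sup>+x. emeasure (expm q) {y. x \<le> c \<and> c < x + y} \<partial>expm r)
       = ennreal r * (\<integral>\<^sup>+x. emeasure (expm r) {y. x \<le> c \<and> c < x + y} \<partial>expm q)"
proof -
  define f where "f r q x = (if 0 \<le> x \<and> x \<le> c then r * q * exp (- r * x) * exp (- q * (c - x)) else 0)"
    for r q x :: real
  have [measurable]: "f r q \<in> borel_measurable borel" for r q unfolding f_def by measurable
  have *: "ennreal q * (\<integral>\<^sup>+x. emeasure (expm q) {y. x \<le> c \<and> c < x + y} \<partial>expm r)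
      = (\<integral>\<^sup>+x. ennreal (f r q x) \<partial>lborel)" if rq: "0 < r" "0 < q" for r q :: real
  proof -
    show ?thesis
      unfolding emeasure_expm_crossing[OF rq(2)]
      by (subst nn_integral_expm, measurable, subst nn_integral_cmult[symmetric], measurable)
        (auto intro!: nn_integral_cong simp: f_def exponential_density_def ennreal_mult[symmetric] rq less_imp_le mult_ac)
  qed
  have "(\<integral>\<^sup>+x. ennreal (f r q x) \<partial>lborel) = (\<integral>\<^sup>+x. ennreal (f r q (c + (-1) * x)) \<partial>lborel)"
    by (subst nn_integral_real_affine[of _ "-1" c]) auto
  also have "\<dots> = (\<integral>\<^sup>+x. ennreal (f q r x) \<partial>lborel)"
    by (intro nn_integral_cong) (auto simp: f_def mult_ac)
  finally show ?thesis using *[OF r q] *[OF q r] by simp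
qed

lemma measurable_component_borel:
  "i \<in> I \<Longrightarrow> (\<And>j. sets (M j) = sets borel) \<Longrightarrow> (\<lambda>s. s i) \<in> borel_measurable (PiM I M)"
  by (metis measurable_cong_sets measurable_component_singleton)

text \<open>By Fubini the coordinates in \<open>J\<close> can be frozen. They merely lower the level
  from \<open>t\<close> to \<open>t - sum w J\<close>, and for the remaining two coordinates the
  claim is \<open>two_exponentials_swap\<close>.\<close>

lemma PiM_exponential_swap:
  fixes r :: "'i \<Rightarrow> real" and t :: real
  assumes r: "\<And>i. 0 < r i" and J: "finite J" "i \<notin> J" "j \<notin> J" "i \<noteq> j"
  defines "M \<equiv> PiM (insert i (insert j J)) (\<lambda>i. expm (r i))"
  shows "ennreal (r j) * emeasure M {s \<in> space M. sum s J + s i \<le> t \<and> t < sum s J + s i + s j}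
       = ennreal (r i) * emeasure M {s \<in> space M. sum s J + s j \<le> t \<and> t < sum s J + s j + s i}"
proof -
  interpret product_prob_space "\<lambda>i. expm (r i)" UNIV
    by (intro product_prob_spaceI prob_space_exponential_density r)
  \<comment> \<open>Proved for arbitrary \<open>i\<close> and \<open>j\<close>, because it is used
    once in each order.\<close>
  have *: "ennreal (r j) * emeasure (PiM (insert j (insert i J)) (\<lambda>i. expm (r i)))
        {s \<in> space (PiM (insert j (insert i J)) (\<lambda>i. expm (r i))). sum s J + s i \<le> t \<and> t < sum s J + s i + s j}
      = (\<integral>\<^sup>+w. ennreal (r j) * (\<integral>\<^sup>+x. emeasure (expm (r j)) {y. x \<le> t - sum w J \<and> t - sum w J < x + y} \<partial>expm (r i))
          \<partial>PiM J (\<lambda>i. expm (r i)))"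
    if ij: "i \<notin> J" "j \<notin> J" "i \<noteq> j" for i j
  proof -
    let ?N = "PiM (insert j (insert i J)) (\<lambda>i. expm (r i))"
    let ?A = "{s \<in> space ?N. sum s J + s i \<le> t \<and> t < sum s J + s i + s j}"
    have c[measurable]: "(\<lambda>s. s k) \<in> borel_measurable (PiM K (\<lambda>i. expm (r i)))" if "k \<in> K" for k K
      using that by (rule measurable_component_borel) simp
    have s[measurable]: "(\<lambda>s. sum s J) \<in> borel_measurable (PiM K (\<lambda>i. expm (r i)))" if "J \<subseteq> K" for K
      using that by (intro borel_measurable_sum c) auto
    have [measurable]: "?A \<in> sets ?N"
    proof -
      have [measurable]: "(\<lambda>s. sum s J) \<in> borel_measurable ?N" by (rule s) auto
      have [measurable]: "(\<lambda>s. s i) \<in> borel_measurable ?N" "(\<lambda>s. s j) \<in> borel_measurable ?N" by (rule c, simp)+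
      show ?thesis by measurable
    qed
    define F where "F v = emeasure (expm (r j)) {y. v i \<le> t - sum v J \<and> t - sum v J < v i + y}" for v
    \<comment> \<open>The closed form makes the measurability of \<open>F\<close> evident.\<close>
    have Fexp: "F v = ennreal (if v i \<le> t - sum v J then exp (- r j * (t - sum v J - v i)) else 0)" for v
      unfolding F_def by (rule emeasure_expm_crossing[OF r])
    have Fm: "F \<in> borel_measurable (PiM (insert i J) (\<lambda>i. expm (r i)))"
    proof -
      have [measurable]: "(\<lambda>s. sum s J) \<in> borel_measurable (PiM (insert i J) (\<lambda>i. expm (r i)))" by (rule s) auto
      have [measurable]: "(\<lambda>s. s i) \<in> borel_measurable (PiM (insert i J) (\<lambda>i. expm (r i)))" by (rule c, simp)
      show ?thesis unfolding Fexp[abs_def] by measurable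
    qed
    have "emeasure ?N ?A = (\<integral>\<^sup>+s. indicator ?A s \<partial>?N)" by simp
    also have "\<dots> = (\<integral>\<^sup>+v. (\<integral>\<^sup>+y. indicator ?A (v(j := y)) \<partial>expm (r j)) \<partial>PiM (insert i J) (\<lambda>i. expm (r i)))"
      using J ij by (intro product_nn_integral_insert) auto
    also have "\<dots> = (\<integral>\<^sup>+v. F v \<partial>PiM (insert i J) (\<lambda>i. expm (r i)))"
    proof (rule nn_integral_cong)
      fix v assume v: "v \<in> space (PiM (insert i J) (\<lambda>i. expm (r i)))"
      have "sum (v(j := y)) J = sum v J" for y using ij by (intro sum.cong) auto
      moreover have "v(j := y) \<in> space ?N" for y
        using v by (auto simp: space_PiM PiE_iff extensional_def)
      ultimately have "indicator ?A (v(j := y)) = (indicator {y. v i \<le> t - sum v J \<and> t - sum v J < v i + y} y :: ennreal)" for y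
        using ij by (auto simp: indicator_def algebra_simps)
      moreover have "{y. v i \<le> t - sum v J \<and> t - sum v J < v i + y} \<in> sets (expm (r j))"
        by simp
      ultimately show "(\<integral>\<^sup>+y. indicator ?A (v(j := y)) \<partial>expm (r j)) = F v"
        by (simp add: F_def)
    qed
    also have "\<dots> = (\<integral>\<^sup>+w. (\<integral>\<^sup>+x. F (w(i := x)) \<partial>expm (r i)) \<partial>PiM J (\<lambda>i. expm (r i)))"
      using J ij Fm by (intro product_nn_integral_insert) auto
    also have "\<dots> = (\<integral>\<^sup>+w. (\<integral>\<^sup>+x. emeasure (expm (r j)) {y. x \<le> t - sum w J \<and> t - sum w J < x + y} \<partial>expm (r i))
        \<partial>PiM J (\<lambda>i. expm (r i)))"
    proof -
      have "sum (w(i := x)) J = sum w J" for w :: "'i \<Rightarrow> real" and x using ij by (intro sum.cong) auto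
      then show ?thesis by (simp only: F_def fun_upd_same)
    qed
    finally have e: "emeasure ?N ?A = \<dots>" .
    show ?thesis
      unfolding e
    proof (rule nn_integral_cmult[symmetric])
      have 2: "(\<lambda>d. \<integral>\<^sup>+x. ennreal (if x \<le> d then exp (- r j * (d - x)) else 0) \<partial>expm (r i)) \<in> borel_measurable borel"
        by measurable
      have [measurable]: "(\<lambda>s. sum s J) \<in> borel_measurable (PiM J (\<lambda>i. expm (r i)))" by (rule s) auto
      have "(\<lambda>w. t - sum w J) \<in> borel_measurable (PiM J (\<lambda>i. expm (r i)))" by measurable
      from measurable_compose[OF this 2]
      show "(\<lambda>w. \<integral>\<^sup>+x. emeasure (expm (r j)) {y. x \<le> t - sum w J \<and> t - sum w J < x + y} \<partial>expm (r i))
          \<in> borel_measurable (PiM J (\<lambda>i. expm (r i)))"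
        unfolding emeasure_expm_crossing[OF r] .
    qed
  qed
  show ?thesis
    unfolding M_def
    using *[of i j] *[of j i] J two_exponentials_swap[OF r r] by (simp add: insert_commute)
qed

text \<open>\<open>hold_prob r k t\<close> is the probability that exactly \<open>k\<close> jumps occur up to time \<open>t\<close> when the
  successive holding times are independent and exponential with rates \<open>r 0, \<dots>, r k\<close>.\<close>

definition hold_prob :: "(nat \<Rightarrow> real) \<Rightarrow> nat \<Rightarrow> real \<Rightarrow> real" where
  "hold_prob r k t = measure (PiM {..k} (\<lambda>i. expm (r i)))
     {s \<in> space (PiM {..k} (\<lambda>_. borel)). (\<Sum>i<k. s i) \<le> t \<and> t < (\<Sum>i\<le>k. s i)}"

lemma hold_prob_cong: "(\<And>i. i \<le> k \<Longrightarrow> r i = r' i) \<Longrightarrow> hold_prob r k t = hold_prob r' k t"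
  unfolding hold_prob_def by (intro arg_cong2[where f = measure] PiM_cong) auto

lemma hold_event_sets:
  fixes k :: nat
  assumes "\<And>i. sets (M i) = sets borel"
  shows "{s \<in> space (PiM {..k} (\<lambda>_. borel)). (\<Sum>i<k. s i :: real) \<le> t \<and> t < (\<Sum>i\<le>k. s i)} \<in> sets (PiM {..k} M)"
proof -
  have "sets (PiM {..k} M) = sets (PiM {..k} (\<lambda>_. borel))"
    by (intro sets_PiM_cong) (auto simp: assms)
  moreover have c: "(\<lambda>s. s i) \<in> borel_measurable (PiM {..k} (\<lambda>_. borel :: real measure))" if "i \<le> k" for i
    by (rule measurable_component_singleton) (use that in simp)
  have [measurable]: "(\<lambda>s. \<Sum>i<k. s i) \<in> borel_measurable (PiM {..k} (\<lambda>_. borel :: real measure))"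
     "(\<lambda>s. \<Sum>i\<le>k. s i) \<in> borel_measurable (PiM {..k} (\<lambda>_. borel :: real measure))"
    by (auto intro!: borel_measurable_sum c)
  have "{s \<in> space (PiM {..k} (\<lambda>_. borel)). (\<Sum>i<k. s i :: real) \<le> t \<and> t < (\<Sum>i\<le>k. s i)} \<in> sets (PiM {..k} (\<lambda>_. borel))"
    by measurable
  ultimately show ?thesis by simp
qed

text \<open>The event depends on the times strictly between the first and the last only through
  their sum. Reversing the coordinates therefore has the sole effect of exchanging the finished time
  0 with the running time \<open>k\<close>, and \<open>PiM_exponential_swap\<close> prices this
  exchange.\<close>

lemma hold_prob_rev:
  assumes r: "\<And>i. 0 < r i"
  shows "r k * hold_prob r k t = r 0 * hold_prob (\<lambda>i. r (k - i)) k t"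
proof (cases "k = 0")
  case False
  let ?M = "PiM {..k} (\<lambda>i. expm (r i))"
  let ?M' = "PiM {..k} (\<lambda>i. expm (r (k - i)))"
  let ?B = "PiM {..k} (\<lambda>_. borel :: real measure)"
  let ?A = "{s \<in> space ?B. (\<Sum>i<k. s i) \<le> t \<and> t < (\<Sum>i\<le>k. s i)}"
  have sp: "space (PiM {..k} (\<lambda>i. expm (f i))) = space ?B" for f :: "nat \<Rightarrow> real"
    by (simp add: space_PiM)
  interpret M: prob_space ?M
    by (intro prob_space_PiM prob_space_exponential_density r)
  \<comment> \<open>The intermediate indices; \<open>k\<close> is positive here, so the first and
    the last index are distinct.\<close>
  define J where "J = {1..<k}"
  have J: "finite J" "0 \<notin> J" "k \<notin> J" "0 \<noteq> k" and atM: "{..k} = insert 0 (insert k J)"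
    and ltk: "{..<k} = insert 0 J" and gt0: "{1..k} = insert k J"
    using False by (auto simp: J_def)
  have s1: "(\<Sum>i<k. s i) = sum s J + s 0" "(\<Sum>i\<le>k. s i) = sum s J + s 0 + s k"
      "(\<Sum>i=1..k. s i) = sum s J + s k" for s :: "nat \<Rightarrow> real"
    unfolding atM ltk gt0 using J by (simp_all add: add_ac)
  \<comment> \<open>Reading the coordinates backwards is a measure-preserving map onto the product
    with reversed rates.\<close>
  have rev: "distr ?M ?M' (\<lambda>\<omega>. \<lambda>n\<in>{..k}. \<omega> (k - n)) = ?M'"
    by (rule distr_PiM_reindex) (auto intro!: prob_space_exponential_density r inj_onI)
  have meas: "(\<lambda>\<omega>. \<lambda>n\<in>{..k}. \<omega> (k - n)) \<in> ?M \<rightarrow>\<^sub>M ?M'"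
    by (intro measurable_restrict measurable_component_singleton) auto
  have "hold_prob (\<lambda>i. r (k - i)) k t = measure (distr ?M ?M' (\<lambda>\<omega>. \<lambda>n\<in>{..k}. \<omega> (k - n))) ?A"
    unfolding hold_prob_def rev ..
  also have "\<dots> = measure ?M ((\<lambda>\<omega>. \<lambda>n\<in>{..k}. \<omega> (k - n)) -` ?A \<inter> space ?M)"
    by (rule measure_distr[OF meas hold_event_sets]) simp
  also have "(\<lambda>\<omega>. \<lambda>n\<in>{..k}. \<omega> (k - n)) -` ?A \<inter> space ?M
     = {s \<in> space ?M. sum s J + s k \<le> t \<and> t < sum s J + s k + s 0}"
  proof -
    have a: "(\<Sum>i<k. (\<lambda>n\<in>{..k}. s (k - n)) i) = sum s J + s k"
      "(\<Sum>i\<le>k. (\<lambda>n\<in>{..k}. s (k - n)) i) = sum s J + s k + s 0" for s :: "nat \<Rightarrow> real"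
    proof -
      have "(\<Sum>i<k. (\<lambda>n\<in>{..k}. s (k - n)) i) = (\<Sum>i=1..k. s i)"
        by (rule sum.reindex_bij_witness[of _ "\<lambda>i. k - i" "\<lambda>i. k - i"]) auto
      then show "(\<Sum>i<k. (\<lambda>n\<in>{..k}. s (k - n)) i) = sum s J + s k" by (simp only: s1)
      have "(\<Sum>i\<le>k. (\<lambda>n\<in>{..k}. s (k - n)) i) = (\<Sum>i\<le>k. s i)"
        by (rule sum.reindex_bij_witness[of _ "\<lambda>i. k - i" "\<lambda>i. k - i"]) auto
      then show "(\<Sum>i\<le>k. (\<lambda>n\<in>{..k}. s (k - n)) i) = sum s J + s k + s 0" by (simp only: s1 add_ac)
    qed
    show ?thesis unfolding vimage_def a mem_Collect_eq by (auto simp: space_PiM)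
  qed
  finally have h2: "ennreal (hold_prob (\<lambda>i. r (k - i)) k t)
      = emeasure ?M {s \<in> space ?M. sum s J + s k \<le> t \<and> t < sum s J + s k + s 0}"
    by (simp add: M.emeasure_eq_measure)
  have h1: "ennreal (hold_prob r k t) = emeasure ?M {s \<in> space ?M. sum s J + s 0 \<le> t \<and> t < sum s J + s 0 + s k}"
    unfolding hold_prob_def s1 by (simp add: M.emeasure_eq_measure sp)
  have "ennreal (r k) * ennreal (hold_prob r k t) = ennreal (r 0) * ennreal (hold_prob (\<lambda>i. r (k - i)) k t)"
    unfolding h1 h2 atM by (rule PiM_exponential_swap[OF r J])
  moreover have "0 \<le> hold_prob f k t" for f by (simp add: hold_prob_def)
  ultimately show ?thesis using r[of k] r[of 0]
    by (simp add: ennreal_mult[symmetric] less_imp_le)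
qed (use hold_prob_cong[of k r "\<lambda>i. r (k - i)"] in auto)


section \<open>Reversible jump processes on a finite state space\<close>

lemma sum_PiE_insert:
  assumes "x \<notin> S"
  shows "(\<Sum>f\<in>PiE (insert x S) T. h f) = (\<Sum>y\<in>T x. \<Sum>g\<in>PiE S T. h (g(x := y)))"
  unfolding PiE_insert_eq
  by (subst sum.reindex[OF inj_combinator[OF assms]])
    (simp add: sum.cartesian_product case_prod_unfold)

lemma emeasure_expm_atMost:
  assumes "0 < r" "0 \<le> a"
  shows "emeasure (expm r) {..a} = ennreal (1 - exp (- r * a))"
proof -
  interpret prob_space "expm r" using assms by (intro prob_space_exponential_density)
  have "prob {..a} = 1 - prob {a<..}"
    using prob_compl[of "{a<..}"] by (simp add: Compl_eq_Diff_UNIV[symmetric])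
  then show ?thesis using emeasure_expm_greaterThan[OF assms] by (simp add: emeasure_eq_measure)
qed

text \<open>Detailed balance is required of the jump intensities \<open>rate a * jp a b\<close>. The
  embedded chain is thus reversible for the weights \<open>w a * rate a\<close>, not for
  \<open>w\<close>. Positive rates exclude absorbing states.\<close>

locale reversible_jump_chain =
  fixes \<Omega> :: "'s set" and rate :: "'s \<Rightarrow> real" and jp :: "'s \<Rightarrow> 's \<Rightarrow> real" and w :: "'s \<Rightarrow> real"
  assumes finite_states: "finite \<Omega>"
    and rate_pos: "a \<in> \<Omega> \<Longrightarrow> 0 < rate a"
    and jp_nonneg: "a \<in> \<Omega> \<Longrightarrow> b \<in> \<Omega> \<Longrightarrow> 0 \<le> jp a b"
    and jp_sum: "a \<in> \<Omega> \<Longrightarrow> (\<Sum>b\<in>\<Omega>. jp a b) = 1"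
    and w_pos: "a \<in> \<Omega> \<Longrightarrow> 0 < w a"
    and balance: "a \<in> \<Omega> \<Longrightarrow> b \<in> \<Omega> \<Longrightarrow> w a * rate a * jp a b = w b * rate b * jp b a"
begin

text \<open>Together with \<open>jump_process\<close> this abstracts \<open>jump_hold\<close> and
  \<open>birth_death_process\<close>: for the state space \<open>Pow C\<close> with the birth-death
  rates the definitions unfold to the same formulas.\<close>

definition jump_law :: "'s \<Rightarrow> 'w measure \<Rightarrow> (nat \<Rightarrow> 'w \<Rightarrow> 's) \<Rightarrow> (nat \<Rightarrow> 'w \<Rightarrow> ennreal) \<Rightarrow> bool" where
  "jump_law a M Z S \<longleftrightarrow>
     (\<forall>i. Z i \<in> M \<rightarrow>\<^sub>M count_space \<Omega>) \<and>
     (\<forall>i. S i \<in> borel_measurable M) \<and>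
     (\<forall>n z s. (\<forall>i\<le>n. z i \<in> \<Omega> \<and> 0 \<le> s i) \<longrightarrow>
        measure M {\<omega> \<in> space M. \<forall>i\<le>n. Z i \<omega> = z i \<and> ennreal (s i) < S i \<omega>} =
          of_bool (z 0 = a) * (\<Prod>i<n. jp (z i) (z (Suc i))) * (\<Prod>i\<le>n. exp (- rate (z i) * s i)))"

definition jump_process :: "'s \<Rightarrow> 'w measure \<Rightarrow> (real \<Rightarrow> 'w \<Rightarrow> 's) \<Rightarrow> bool" where
  "jump_process a M X \<longleftrightarrow>
     prob_space M \<and>
     (\<forall>t\<ge>0. X t \<in> M \<rightarrow>\<^sub>M count_space \<Omega>) \<and>
     (\<exists>Z S. jump_law a M Z S \<and>
        (AE \<omega> in M. \<forall>t\<ge>0. \<forall>k. (\<Sum>i<k. S i \<omega>) \<le> ennreal t \<and> ennreal t < (\<Sum>i\<le>k. S i \<omega>)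
                       \<longrightarrow> X t \<omega> = Z k \<omega>))"

section \<open>Weights of finite paths and their reversal\<close>

definition path_prob :: "'s \<Rightarrow> (nat \<Rightarrow> 's) \<Rightarrow> nat \<Rightarrow> real" where
  "path_prob a z k = of_bool (z 0 = a) * (\<Prod>i<k. jp (z i) (z (Suc i)))"

text \<open>Extensional functions give every path of \<open>k\<close> jumps exactly one
  representative, so sums over paths are finite.\<close>

definition paths :: "nat \<Rightarrow> (nat \<Rightarrow> 's) set" where
  "paths k = PiE {..k} (\<lambda>_. \<Omega>)"

lemma finite_paths: "finite (paths k)"
  unfolding paths_def by (intro finite_PiE) (auto simp: finite_states)

lemma pathsD: "z \<in> paths k \<Longrightarrow> i \<le> k \<Longrightarrow> z i \<in> \<Omega>"
  by (auto simp: paths_def)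

lemma path_prob_nonneg: "z \<in> paths k \<Longrightarrow> 0 \<le> path_prob a z k"
  unfolding path_prob_def by (intro mult_nonneg_nonneg prod_nonneg) (auto intro!: jp_nonneg pathsD)

text \<open>Splitting off the last state leaves a row sum of \<open>jp\<close>, which is 1.\<close>

lemma path_prob_sum:
  assumes "a \<in> \<Omega>"
  shows "(\<Sum>z\<in>paths k. path_prob a z k) = 1"
proof (induction k)
  case 0
  have "{..0::nat} = insert 0 {}" by auto
  then show ?case using assms finite_states
    by (simp add: paths_def sum_PiE_insert path_prob_def of_bool_def del: insert_iff)
next
  case (Suc k)
  have "(\<Sum>z\<in>paths (Suc k). path_prob a z (Suc k))
      = (\<Sum>y\<in>\<Omega>. \<Sum>g\<in>paths k. path_prob a (g(Suc k := y)) (Suc k))"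
    unfolding paths_def atMost_Suc by (subst sum_PiE_insert) auto
  also have "\<dots> = (\<Sum>y\<in>\<Omega>. \<Sum>g\<in>paths k. path_prob a g k * jp (g k) y)"
    by (intro sum.cong refl) (auto simp: path_prob_def)
  also have "\<dots> = (\<Sum>g\<in>paths k. path_prob a g k * (\<Sum>y\<in>\<Omega>. jp (g k) y))"
    by (subst sum.swap) (simp add: sum_distrib_left)
  also have "\<dots> = (\<Sum>g\<in>paths k. path_prob a g k)"
    by (intro sum.cong refl) (simp add: jp_sum pathsD)
  finally show ?case using Suc by simp
qed

text \<open>This will be the probability of having made exactly \<open>k\<close> jumps by time
  \<open>t\<close> and being in \<open>b\<close>, for a start in \<open>a\<close>; see
  \<open>prob_state_after_jumps\<close>. As an explicit finite sum it can be reversed path by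
  path.\<close>

definition occ :: "nat \<Rightarrow> real \<Rightarrow> 's \<Rightarrow> 's \<Rightarrow> real" where
  "occ k t a b = (\<Sum>z\<in>paths k. of_bool (z k = b) * (path_prob a z k * hold_prob (\<lambda>i. rate (z i)) k t))"

text \<open>Detailed balance is applied edge by edge, each time carrying the factor
  \<open>w * rate\<close> one state further along the path.\<close>

lemma path_balance:
  assumes "\<And>i. i \<le> k \<Longrightarrow> z i \<in> \<Omega>"
  shows "w (z 0) * rate (z 0) * (\<Prod>i<k. jp (z i) (z (Suc i)))
       = w (z k) * rate (z k) * (\<Prod>i<k. jp (z (Suc i)) (z i))"
  using assms
proof (induction k)
  case (Suc k)
  have "w (z 0) * rate (z 0) * (\<Prod>i<Suc k. jp (z i) (z (Suc i)))
      = (w (z k) * rate (z k) * jp (z k) (z (Suc k))) * (\<Prod>i<k. jp (z (Suc i)) (z i))"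
    using Suc by simp
  also have "w (z k) * rate (z k) * jp (z k) (z (Suc k)) = w (z (Suc k)) * rate (z (Suc k)) * jp (z (Suc k)) (z k)"
    using Suc by (intro balance) auto
  finally show ?case by (simp add: mult_ac)
qed simp

text \<open>Path reversal \<open>rv\<close> is an involution matching the two sums. Reversing the
  jump factors costs a ratio of \<open>w * rate\<close> at the end points, reversing the holding
  times costs the inverse ratio of \<open>rate\<close>, and only the ratio of \<open>w\<close>
  survives.\<close>

lemma occ_reversible: "w a * occ k t a b = w b * occ k t b a"
proof -
  define rv where "rv z = (\<lambda>i\<in>{..k}. z (k - i))" for z :: "nat \<Rightarrow> 's"
  define wt where "wt a b z = of_bool (z k = b) * (path_prob a z k * hold_prob (\<lambda>i. rate (z i)) k t)" for a b z
  have rvin: "rv z \<in> paths k" if "z \<in> paths k" for z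
    using that by (auto simp: rv_def paths_def)
  have rvrv: "rv (rv z) = z" if "z \<in> paths k" for z
    using that by (auto simp: rv_def paths_def PiE_iff extensional_def fun_eq_iff)
  have eq: "w a * wt a b z = w b * wt b a (rv z)" if z: "z \<in> paths k" for z
  proof (cases "z 0 = a \<and> z k = b")
    case False
    then show ?thesis by (auto simp: wt_def path_prob_def rv_def)
  next
    case True
    let ?P = "\<Prod>i<k. jp (z i) (z (Suc i))" and ?P' = "\<Prod>i<k. jp (z (Suc i)) (z i)"
    let ?h = "hold_prob (\<lambda>i. rate (z i)) k t" and ?h' = "hold_prob (\<lambda>i. rate (rv z i)) k t"
    have ab: "a \<in> \<Omega>" "b \<in> \<Omega>" using True pathsD[OF z, of 0] pathsD[OF z, of k] by auto
    have P: "w a * rate a * ?P = w b * rate b * ?P'"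
      using path_balance[of k z] pathsD[OF z] True by simp
    \<comment> \<open>For \<open>i < k\<close> the index \<open>k - i\<close> is
      \<open>Suc (k - Suc i)\<close>, which puts the product in the form of a reindexing.\<close>
    have "(\<Prod>i<k. jp (rv z i) (rv z (Suc i))) = (\<Prod>i<k. jp (z (Suc (k - Suc i))) (z (k - Suc i)))"
      by (intro prod.cong) (auto simp: rv_def Suc_diff_Suc)
    also have "\<dots> = ?P'" by (rule prod.nat_diff_reindex)
    finally have P': "(\<Prod>i<k. jp (rv z i) (rv z (Suc i))) = ?P'" .
    \<comment> \<open>\<open>hold_prob_rev\<close> wants positive rates at every index, so the rates
      are continued constantly beyond \<open>k\<close>.\<close>
    define r where "r i = rate (z (min i k))" for i
    have "r k * hold_prob r k t = r 0 * hold_prob (\<lambda>i. r (k - i)) k t"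
      by (rule hold_prob_rev) (auto simp: r_def intro!: rate_pos pathsD[OF z])
    also have "hold_prob r k t = ?h" by (rule hold_prob_cong) (simp add: r_def)
    also have "hold_prob (\<lambda>i. r (k - i)) k t = ?h'" by (rule hold_prob_cong) (simp add: r_def rv_def)
    finally have h: "rate b * ?h = rate a * ?h'" using True by (simp add: r_def)
    have "rate a * rate b * (w a * (?P * ?h)) = (w a * rate a * ?P) * (rate b * ?h)" by simp
    also have "\<dots> = rate a * rate b * (w b * (?P' * ?h'))" unfolding P h by simp
    finally have "w a * (?P * ?h) = w b * (?P' * ?h')"
      using rate_pos[OF ab(1)] rate_pos[OF ab(2)] by simp
    then show ?thesis using True by (simp add: wt_def path_prob_def P' ) (simp add: rv_def)
  qed
  have "w a * occ k t a b = (\<Sum>z\<in>paths k. w a * wt a b z)"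
    by (simp add: occ_def wt_def sum_distrib_left)
  also have "\<dots> = (\<Sum>z\<in>paths k. w b * wt b a z)"
    by (rule sum.reindex_bij_witness[of _ rv rv]) (auto simp: rvin rvrv eq)
  also have "\<dots> = w b * occ k t b a"
    by (simp add: occ_def wt_def sum_distrib_left)
  finally show ?thesis .
qed

section \<open>The law of the holding times along a given path\<close>

lemma jump_lawD:
  assumes "jump_law a M Z S" "\<And>i. i \<le> k \<Longrightarrow> z i \<in> \<Omega>" "\<And>i. i \<le> k \<Longrightarrow> 0 \<le> s i"
  shows "measure M {\<omega> \<in> space M. \<forall>i\<le>k. Z i \<omega> = z i \<and> ennreal (s i) < S i \<omega>}
      = path_prob a z k * (\<Prod>i\<le>k. exp (- rate (z i) * s i))"
  using assms unfolding jump_law_def path_prob_def by blast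

text \<open>Conditionally on following \<open>z\<close>, the joint survival function of the times is
  a product of exponentials, so \<open>joint_exponential_law\<close> applies under the conditional
  measure. \<open>Q\<close> and \<open>E\<close> describe one event, in extended and in real times;
  they need to agree for finite times only, the rest being null.\<close>

lemma path_law:
  fixes Z :: "nat \<Rightarrow> 'w \<Rightarrow> 's"
  assumes M: "prob_space M" and law: "jump_law a M Z S"
    and z: "\<And>i. i \<le> k \<Longrightarrow> z i \<in> \<Omega>"
    and E: "E \<in> sets (PiM {..k} (\<lambda>_. borel))" and Q[measurable]: "Measurable.pred M Q"
    and QE: "\<And>\<omega>. \<omega> \<in> space M \<Longrightarrow> (\<And>i. i \<le> k \<Longrightarrow> S i \<omega> < \<infinity>) \<Longrightarrow>
        Q \<omega> \<longleftrightarrow> (\<lambda>i\<in>{..k}. enn2real (S i \<omega>)) \<in> E"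
  shows "measure M {\<omega> \<in> space M. (\<forall>i\<le>k. Z i \<omega> = z i \<and> 0 < S i \<omega>) \<and> Q \<omega>}
    = path_prob a z k * measure (PiM {..k} (\<lambda>i. expm (rate (z i)))) E"
proof -
  interpret prob_space M by fact
  have S[measurable]: "S i \<in> borel_measurable M" for i
    using law unfolding jump_law_def by blast
  have Z[measurable]: "Z i \<in> M \<rightarrow>\<^sub>M count_space \<Omega>" for i
    using law unfolding jump_law_def by blast
  have surv: "prob {\<omega> \<in> space M. \<forall>i\<le>k. Z i \<omega> = z i \<and> ennreal (s i) < S i \<omega>}
      = path_prob a z k * (\<Prod>i\<le>k. exp (- rate (z i) * s i))" if "\<And>i. i \<le> k \<Longrightarrow> 0 \<le> s i" for s
    using law z that by (rule jump_lawD)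
  \<comment> \<open>Positivity is part of the event because the defining law speaks of strict
    inequalities; thresholds 0 give its probability.\<close>
  define A where "A = {\<omega> \<in> space M. \<forall>i\<le>k. Z i \<omega> = z i \<and> 0 < S i \<omega>}"
  have A[measurable]: "A \<in> sets M" unfolding A_def by measurable
  have pA: "prob A = path_prob a z k" using surv[of "\<lambda>_. 0"] by (simp add: A_def)
  have eq: "{\<omega> \<in> space M. (\<forall>i\<le>k. Z i \<omega> = z i \<and> 0 < S i \<omega>) \<and> Q \<omega>} = A \<inter> {\<omega> \<in> space M. Q \<omega>}"
    by (auto simp: A_def)
  show ?thesis
  proof (cases "prob A = 0")
    \<comment> \<open>Conditioning on a null path is impossible, but both sides are then 0.\<close>
    case True
    have "prob (A \<inter> {\<omega> \<in> space M. Q \<omega>}) \<le> prob A" by (rule finite_measure_mono) auto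
    then show ?thesis using True pA by (simp add: eq measure_le_0_iff)
  next
    case False
    define U where "U = uniform_measure M A"
    have eA: "emeasure M A \<noteq> 0" "emeasure M A \<noteq> \<infinity>" using False by (auto simp: emeasure_eq_measure)
    interpret U: prob_space U unfolding U_def by (rule prob_space_uniform_measure[OF eA])
    have spU: "space U = space M" and sU[measurable_cong]: "sets U = sets M" by (simp_all add: U_def)
    have mU: "measure U B = prob (A \<inter> B) / prob A" if "B \<in> sets M" for B
      unfolding U_def by (rule measure_uniform_measure[OF eA that])
    have r: "0 < rate (z i)" if "i \<le> k" for i using z[OF that] by (rule rate_pos)
    have sv: "measure U {\<omega> \<in> space U. \<forall>i\<le>k. ennreal (s i) < S i \<omega>} = (\<Prod>i\<le>k. exp (- rate (z i) * s i))"
      if s: "\<And>i. i \<le> k \<Longrightarrow> 0 \<le> s i" for s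
    proof -
      have "A \<inter> {\<omega> \<in> space U. \<forall>i\<le>k. ennreal (s i) < S i \<omega>}
          = {\<omega> \<in> space M. \<forall>i\<le>k. Z i \<omega> = z i \<and> ennreal (s i) < S i \<omega>}"
        by (auto simp: A_def spU intro: le_less_trans[OF zero_le])
      then show ?thesis using surv[OF s] False by (subst mU) (auto simp: pA spU)
    qed
    have SU: "S i \<in> borel_measurable U" for i by measurable
    note jl = joint_exponential_law[where k = k and r = "\<lambda>i. rate (z i)", OF U.prob_space_axioms SU r sv]
    have "AE \<omega> in U. \<forall>i\<le>k. S i \<omega> < \<infinity>" by (rule jl(1)) auto
    have vec: "(\<lambda>\<omega>. \<lambda>i\<in>{..k}. enn2real (S i \<omega>)) \<in> U \<rightarrow>\<^sub>M PiM {..k} (\<lambda>_. borel)"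
      by measurable
    let ?V = "(\<lambda>\<omega>. \<lambda>i\<in>{..k}. enn2real (S i \<omega>)) -` E \<inter> space U"
    have "measure U {\<omega> \<in> space M. Q \<omega>} = measure U ?V"
    proof (rule U.finite_measure_eq_AE)
      show "AE \<omega> in U. \<omega> \<in> {\<omega> \<in> space M. Q \<omega>} \<longleftrightarrow> \<omega> \<in> ?V"
        using \<open>AE \<omega> in U. \<forall>i\<le>k. S i \<omega> < \<infinity>\<close> AE_space
        by eventually_elim (use QE in \<open>auto simp: spU\<close>)
      show "?V \<in> sets U" by (rule measurable_sets[OF vec E])
    qed (auto simp: sU)
    also have "\<dots> = measure (distr U (PiM {..k} (\<lambda>_. borel)) (\<lambda>\<omega>. \<lambda>i\<in>{..k}. enn2real (S i \<omega>))) E"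
      by (rule measure_distr[OF vec E, symmetric])
    also have "distr U (PiM {..k} (\<lambda>_. borel)) (\<lambda>\<omega>. \<lambda>i\<in>{..k}. enn2real (S i \<omega>))
        = PiM {..k} (\<lambda>i. expm (rate (z i)))"
      by (rule jl(2)) auto
    finally show ?thesis using False by (subst (asm) mU) (auto simp: eq pA field_simps)
  qed
qed

section \<open>Decomposition over paths and absence of explosion\<close>

context
  fixes a M and Z :: "nat \<Rightarrow> 'w \<Rightarrow> 's" and S
  assumes a: "a \<in> \<Omega>" and M: "prob_space M" and law: "jump_law a M Z S"
begin

interpretation prob_space M by (rule M)

lemma S_meas[measurable]: "S i \<in> borel_measurable M"
  using law unfolding jump_law_def by blast

lemma Z_meas[measurable]: "Z i \<in> M \<rightarrow>\<^sub>M count_space \<Omega>"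
  using law unfolding jump_law_def by blast

text \<open>The positivity of the times is carried along because \<open>hold_pos\<close> is itself
  derived from this splitting.\<close>

lemma path_event_split:
  assumes [measurable]: "Measurable.pred M Q"
  shows "prob {\<omega> \<in> space M. (\<forall>i\<le>k. 0 < S i \<omega>) \<and> Q \<omega>}
     = (\<Sum>z\<in>paths k. prob {\<omega> \<in> space M. (\<forall>i\<le>k. Z i \<omega> = z i \<and> 0 < S i \<omega>) \<and> Q \<omega>})"
proof -
  let ?A = "\<lambda>z. {\<omega> \<in> space M. (\<forall>i\<le>k. Z i \<omega> = z i \<and> 0 < S i \<omega>) \<and> Q \<omega>}"
  have "{\<omega> \<in> space M. (\<forall>i\<le>k. 0 < S i \<omega>) \<and> Q \<omega>} = (\<Union>z\<in>paths k. ?A z)"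
  proof (intro set_eqI iffI)
    fix \<omega> assume \<omega>: "\<omega> \<in> {\<omega> \<in> space M. (\<forall>i\<le>k. 0 < S i \<omega>) \<and> Q \<omega>}"
    then have "(\<lambda>i\<in>{..k}. Z i \<omega>) \<in> paths k"
      using measurable_space[OF Z_meas] by (auto simp: paths_def)
    with \<omega> show "\<omega> \<in> (\<Union>z\<in>paths k. ?A z)" by (intro UN_I) auto
  qed auto
  also have "prob \<dots> = (\<Sum>z\<in>paths k. prob (?A z))"
  proof (rule finite_measure_finite_Union)
    show "disjoint_family_on ?A (paths k)"
      unfolding disjoint_family_on_def
    proof (intro ballI impI)
      fix z z' assume zz: "z \<in> paths k" "z' \<in> paths k" "z \<noteq> z'"
      then obtain i where "i \<le> k" "z i \<noteq> z' i"
        unfolding paths_def by (metis PiE_ext atMost_iff)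
      then show "?A z \<inter> ?A z' = {}" by auto
    qed
    show "?A ` paths k \<subseteq> events"
    proof (rule image_subsetI)
      show "?A z \<in> events" for z by measurable
    qed
  qed (rule finite_paths)
  finally show ?thesis .
qed

text \<open>With thresholds 0 the path events have the probabilities \<open>path_prob\<close>, which
  add up to 1.\<close>

lemma hold_pos: "AE \<omega> in M. \<forall>i\<le>k. 0 < S i \<omega>"
proof -
  have "prob {\<omega> \<in> space M. (\<forall>i\<le>k. 0 < S i \<omega>) \<and> True}
     = (\<Sum>z\<in>paths k. prob {\<omega> \<in> space M. (\<forall>i\<le>k. Z i \<omega> = z i \<and> 0 < S i \<omega>) \<and> True})"
    by (rule path_event_split) simp
  also have "\<dots> = (\<Sum>z\<in>paths k. path_prob a z k)"
  proof (intro sum.cong refl)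
    fix z assume z: "z \<in> paths k"
    show "prob {\<omega> \<in> space M. (\<forall>i\<le>k. Z i \<omega> = z i \<and> 0 < S i \<omega>) \<and> True} = path_prob a z k"
      using jump_lawD[OF law, of k z "\<lambda>_. 0"] pathsD[OF z] by simp
  qed
  also have "\<dots> = 1" by (rule path_prob_sum[OF a])
  finally have "prob {\<omega> \<in> space M. \<forall>i\<le>k. 0 < S i \<omega>} = 1" by simp
  then show ?thesis by (subst (asm) prob_Collect_eq_1) auto
qed

lemma path_decomposition:
  assumes [measurable]: "Measurable.pred M Q"
  shows "prob {\<omega> \<in> space M. Q \<omega>}
     = (\<Sum>z\<in>paths k. prob {\<omega> \<in> space M. (\<forall>i\<le>k. Z i \<omega> = z i \<and> 0 < S i \<omega>) \<and> Q \<omega>})"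
proof -
  have "prob {\<omega> \<in> space M. Q \<omega>} = prob {\<omega> \<in> space M. (\<forall>i\<le>k. 0 < S i \<omega>) \<and> Q \<omega>}"
  proof (rule finite_measure_eq_AE)
    show "AE \<omega> in M. \<omega> \<in> {\<omega> \<in> space M. Q \<omega>} \<longleftrightarrow> \<omega> \<in> {\<omega> \<in> space M. (\<forall>i\<le>k. 0 < S i \<omega>) \<and> Q \<omega>}"
      using hold_pos[of k] by eventually_elim auto
  qed auto
  then show ?thesis using path_event_split[of Q k] by simp
qed

lemma prob_state_after_jumps:
  assumes b: "b \<in> \<Omega>" and t: "0 \<le> t"
  shows "prob {\<omega> \<in> space M. Z k \<omega> = b \<and> (\<Sum>i<k. S i \<omega>) \<le> ennreal t \<and> ennreal t < (\<Sum>i\<le>k. S i \<omega>)} = occ k t a b"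
proof -
  let ?Q = "\<lambda>\<omega>. (\<Sum>i<k. S i \<omega>) \<le> ennreal t \<and> ennreal t < (\<Sum>i\<le>k. S i \<omega>)"
  let ?E = "{s \<in> space (PiM {..k} (\<lambda>_. borel)). (\<Sum>i<k. s i) \<le> t \<and> t < (\<Sum>i\<le>k. s i)}"
  have [measurable]: "Measurable.pred M ?Q" by measurable
  \<comment> \<open>For finite times the sums are images of real sums, and \<open>0 <= t\<close>
    keeps \<open>ennreal t\<close> from truncating \<open>t\<close>.\<close>
  have QE: "?Q \<omega> \<longleftrightarrow> (\<lambda>i\<in>{..k}. enn2real (S i \<omega>)) \<in> ?E" if fin: "\<And>i. i \<le> k \<Longrightarrow> S i \<omega> < \<infinity>" for \<omega>
  proof -
    have S: "S i \<omega> = ennreal (enn2real (S i \<omega>))" if "i \<le> k" for i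
      using fin[OF that] by (simp add: less_top)
    have "(\<Sum>i<k. S i \<omega>) = (\<Sum>i<k. ennreal (enn2real (S i \<omega>)))"
      by (intro sum.cong refl S) auto
    moreover have "(\<Sum>i\<le>k. S i \<omega>) = (\<Sum>i\<le>k. ennreal (enn2real (S i \<omega>)))"
      by (intro sum.cong refl S) auto
    ultimately show ?thesis using t
      by (simp add: ennreal_less_iff space_PiM sum_nonneg)
  qed
  have "prob {\<omega> \<in> space M. Z k \<omega> = b \<and> ?Q \<omega>}
     = (\<Sum>z\<in>paths k. prob {\<omega> \<in> space M. (\<forall>i\<le>k. Z i \<omega> = z i \<and> 0 < S i \<omega>) \<and> Z k \<omega> = b \<and> ?Q \<omega>})"
  proof (rule path_decomposition)
    have [measurable]: "Measurable.pred M (\<lambda>\<omega>. Z k \<omega> = b)"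
      using b by (auto intro!: pred_count_space_const1)
    show "Measurable.pred M (\<lambda>\<omega>. Z k \<omega> = b \<and> ?Q \<omega>)" by measurable
  qed
  also have "\<dots> = occ k t a b"
    unfolding occ_def
  proof (intro sum.cong refl)
    fix z assume z: "z \<in> paths k"
    show "prob {\<omega> \<in> space M. (\<forall>i\<le>k. Z i \<omega> = z i \<and> 0 < S i \<omega>) \<and> Z k \<omega> = b \<and> ?Q \<omega>}
        = of_bool (z k = b) * (path_prob a z k * hold_prob (\<lambda>i. rate (z i)) k t)"
    proof (cases "z k = b")
      case True
      then have "{\<omega> \<in> space M. (\<forall>i\<le>k. Z i \<omega> = z i \<and> 0 < S i \<omega>) \<and> Z k \<omega> = b \<and> ?Q \<omega>}
         = {\<omega> \<in> space M. (\<forall>i\<le>k. Z i \<omega> = z i \<and> 0 < S i \<omega>) \<and> ?Q \<omega>}" by auto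
      also have "prob \<dots> = path_prob a z k * measure (PiM {..k} (\<lambda>i. expm (rate (z i)))) ?E"
        by (rule path_law[OF M law pathsD[OF z] hold_event_sets _ QE]) auto
      finally show ?thesis using True by (simp add: hold_prob_def)
    next
      case False
      then have "{\<omega> \<in> space M. (\<forall>i\<le>k. Z i \<omega> = z i \<and> 0 < S i \<omega>) \<and> Z k \<omega> = b \<and> ?Q \<omega>} = {}" by auto
      then have "prob {\<omega> \<in> space M. (\<forall>i\<le>k. Z i \<omega> = z i \<and> 0 < S i \<omega>) \<and> Z k \<omega> = b \<and> ?Q \<omega>} = 0"
        by (simp only: measure_empty)
      then show ?thesis using False by simp
    qed
  qed
  finally show ?thesis .
qed

text \<open>Along each path the times are independent, and one of rate at most \<open>R\<close> is
  at most \<open>t\<close> with probability at most \<open>1 - exp (- R * t)\<close>.\<close>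

lemma hold_all_le_bound:
  assumes t: "0 \<le> t" and R: "\<And>b. b \<in> \<Omega> \<Longrightarrow> rate b \<le> R"
  shows "prob {\<omega> \<in> space M. \<forall>i\<le>k. S i \<omega> \<le> ennreal t} \<le> (1 - exp (- R * t)) ^ Suc k"
proof -
  let ?Q = "\<lambda>\<omega>. \<forall>i\<le>k. S i \<omega> \<le> ennreal t"
  let ?E = "PiE {..k} (\<lambda>_. {..t})"
  have E: "?E \<in> sets (PiM {..k} (\<lambda>_. borel))" by (intro sets_PiM_I_finite) auto
  have "prob {\<omega> \<in> space M. ?Q \<omega>}
     = (\<Sum>z\<in>paths k. prob {\<omega> \<in> space M. (\<forall>i\<le>k. Z i \<omega> = z i \<and> 0 < S i \<omega>) \<and> ?Q \<omega>})"
    by (rule path_decomposition) measurable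
  also have "\<dots> \<le> (\<Sum>z\<in>paths k. path_prob a z k * (1 - exp (- R * t)) ^ Suc k)"
  proof (rule sum_mono)
    fix z assume z: "z \<in> paths k"
    have QE: "?Q \<omega> \<longleftrightarrow> (\<lambda>i\<in>{..k}. enn2real (S i \<omega>)) \<in> ?E" if fin: "\<And>i. i \<le> k \<Longrightarrow> S i \<omega> < \<infinity>" for \<omega>
    proof -
      have "S i \<omega> \<le> ennreal t \<longleftrightarrow> enn2real (S i \<omega>) \<le> t" if "i \<le> k" for i
        using fin[OF that] t by (cases "S i \<omega>") auto
      then show ?thesis by (auto simp: PiE_iff)
    qed
    define r where "r i = rate (z (min i k))" for i
    have r: "0 < r i" for i by (auto simp: r_def intro!: rate_pos pathsD[OF z])
    interpret N: product_prob_space "\<lambda>i. expm (r i)" UNIV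
      by (intro product_prob_spaceI prob_space_exponential_density r)
    have PiMr: "PiM {..k} (\<lambda>i. expm (rate (z i))) = PiM {..k} (\<lambda>i. expm (r i))"
      by (intro PiM_cong) (auto simp: r_def)
    have "emeasure (PiM {..k} (\<lambda>i. expm (r i))) ?E = (\<Prod>i\<le>k. emeasure (expm (r i)) {..t})"
      by (rule N.emeasure_PiM) auto
    also have "\<dots> = (\<Prod>i\<le>k. ennreal (1 - exp (- r i * t)))"
      by (simp only: emeasure_expm_atMost[OF r t])
    also have "\<dots> = ennreal (\<Prod>i\<le>k. 1 - exp (- r i * t))"
      using r t by (intro prod_ennreal) (simp add: less_imp_le)
    finally have "measure (PiM {..k} (\<lambda>i. expm (rate (z i)))) ?E = (\<Prod>i\<le>k. 1 - exp (- r i * t))"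
      unfolding PiMr using r t
      by (intro measure_eq_emeasure_eq_ennreal prod_nonneg) (auto simp: less_imp_le)
    also have "\<dots> \<le> (\<Prod>i\<le>k. 1 - exp (- R * t))"
    proof (rule prod_mono)
      fix i
      have "r i \<le> R" by (auto simp: r_def intro!: R pathsD[OF z])
      then have "r i * t \<le> R * t" using t by (rule mult_right_mono)
      then show "0 \<le> 1 - exp (- r i * t) \<and> 1 - exp (- r i * t) \<le> 1 - exp (- R * t)"
        using r[of i] t by simp
    qed
    finally have le: "measure (PiM {..k} (\<lambda>i. expm (rate (z i)))) ?E \<le> (1 - exp (- R * t)) ^ Suc k"
      by simp
    have "prob {\<omega> \<in> space M. (\<forall>i\<le>k. Z i \<omega> = z i \<and> 0 < S i \<omega>) \<and> ?Q \<omega>}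
        = path_prob a z k * measure (PiM {..k} (\<lambda>i. expm (rate (z i)))) ?E"
      by (rule path_law[OF M law pathsD[OF z] E _ QE]) auto
    also have "\<dots> \<le> path_prob a z k * (1 - exp (- R * t)) ^ Suc k"
      by (intro mult_left_mono le path_prob_nonneg z)
    finally show "prob {\<omega> \<in> space M. (\<forall>i\<le>k. Z i \<omega> = z i \<and> 0 < S i \<omega>) \<and> ?Q \<omega>}
        \<le> path_prob a z k * (1 - exp (- R * t)) ^ Suc k" .
  qed
  also have "\<dots> = (1 - exp (- R * t)) ^ Suc k"
    by (simp add: sum_distrib_right[symmetric] path_prob_sum[OF a])
  finally show ?thesis .
qed

text \<open>If no partial sum exceeds \<open>t\<close>, then all holding times are at most
  \<open>t\<close>. A finite state space has a largest rate, so the bound above decays geometrically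
  in the number of jumps.\<close>

lemma no_explosion:
  assumes t: "0 \<le> t"
  shows "AE \<omega> in M. \<exists>k. (\<Sum>i<k. S i \<omega>) \<le> ennreal t \<and> ennreal t < (\<Sum>i\<le>k. S i \<omega>)"
proof -
  define R where "R = Max (rate ` \<Omega>)"
  have R: "rate b \<le> R" if "b \<in> \<Omega>" for b unfolding R_def using that finite_states by simp
  have R0: "0 < R" using rate_pos[OF a] R[OF a] by simp
  have "prob {\<omega> \<in> space M. \<forall>i. S i \<omega> \<le> ennreal t} \<le> (1 - exp (- R * t)) ^ Suc k" for k
  proof -
    have "prob {\<omega> \<in> space M. \<forall>i. S i \<omega> \<le> ennreal t} \<le> prob {\<omega> \<in> space M. \<forall>i\<le>k. S i \<omega> \<le> ennreal t}"
      by (rule finite_measure_mono) auto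
    also have "\<dots> \<le> (1 - exp (- R * t)) ^ Suc k" by (rule hold_all_le_bound[OF t R])
    finally show ?thesis .
  qed
  moreover have "(\<lambda>k. (1 - exp (- R * t)) ^ Suc k) \<longlonglongrightarrow> 0"
    using mult_nonneg_nonneg[OF less_imp_le[OF R0] t]
    by (intro LIMSEQ_Suc LIMSEQ_power_zero) (simp add: abs_if)
  ultimately have "prob {\<omega> \<in> space M. \<forall>i. S i \<omega> \<le> ennreal t} \<le> 0"
    by (intro LIMSEQ_le_const) auto
  then have "prob {\<omega> \<in> space M. \<forall>i. S i \<omega> \<le> ennreal t} = 0" by (simp add: measure_le_0_iff)
  then have "AE \<omega> in M. \<not> (\<forall>i. S i \<omega> \<le> ennreal t)" by (subst (asm) prob_Collect_eq_0) auto
  then show ?thesis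
  proof eventually_elim
    case (elim \<omega>)
    then obtain i where "ennreal t < S i \<omega>" by (auto simp: not_le)
    also have "S i \<omega> \<le> (\<Sum>i\<le>i. S i \<omega>)" by (rule member_le_sum) auto
    finally have ex: "\<exists>k. ennreal t < (\<Sum>i\<le>k. S i \<omega>)" ..
    \<comment> \<open>By minimality the preceding partial sum is still at most \<open>t\<close>; for
      \<open>k = 0\<close> it is the empty sum.\<close>
    define k where "k = (LEAST k. ennreal t < (\<Sum>i\<le>k. S i \<omega>))"
    have 1: "ennreal t < (\<Sum>i\<le>k. S i \<omega>)" unfolding k_def using ex by (rule LeastI_ex)
    have "(\<Sum>i<k. S i \<omega>) \<le> ennreal t"
    proof (cases k)
      case (Suc j)
      then have "\<not> ennreal t < (\<Sum>i\<le>j. S i \<omega>)" unfolding k_def by (intro not_less_Least) simp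
      then show ?thesis using Suc by (simp add: not_less lessThan_Suc_atMost)
    qed simp
    with 1 show ?case by blast
  qed
qed

end

section \<open>Transition probabilities of the process\<close>

lemma jump_processE:
  assumes "jump_process a M X" and t: "0 \<le> t"
  obtains Z S where "prob_space M" "X t \<in> M \<rightarrow>\<^sub>M count_space \<Omega>" "jump_law a M Z S"
    "AE \<omega> in M. \<forall>k. (\<Sum>i<k. S i \<omega>) \<le> ennreal t \<and> ennreal t < (\<Sum>i\<le>k. S i \<omega>) \<longrightarrow> X t \<omega> = Z k \<omega>"
proof -
  from assms obtain Z S where *: "prob_space M" "X t \<in> M \<rightarrow>\<^sub>M count_space \<Omega>" "jump_law a M Z S"
    and XZ: "AE \<omega> in M. \<forall>t\<ge>0. \<forall>k. (\<Sum>i<k. S i \<omega>) \<le> ennreal t \<and> ennreal t < (\<Sum>i\<le>k. S i \<omega>)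
                       \<longrightarrow> X t \<omega> = Z k \<omega>"
    unfolding jump_process_def by (elim conjE exE) simp
  from XZ have "AE \<omega> in M. \<forall>k. (\<Sum>i<k. S i \<omega>) \<le> ennreal t \<and> ennreal t < (\<Sum>i\<le>k. S i \<omega>) \<longrightarrow> X t \<omega> = Z k \<omega>"
    by eventually_elim (use t in blast)
  with * show ?thesis by (rule that)
qed

text \<open>The events are sorted by the number of jumps made. They are disjoint because partial
  sums increase, and exhaustive up to a null set because there is no explosion.\<close>

lemma trans_prob_sums:
  assumes a: "a \<in> \<Omega>" and b: "b \<in> \<Omega>" and t: "0 \<le> t" and X: "jump_process a M X"
  shows "(\<lambda>k. occ k t a b) sums measure M {\<omega> \<in> space M. X t \<omega> = b}"
proof -
  from X t obtain Z S where M: "prob_space M" and Xm[measurable]: "X t \<in> M \<rightarrow>\<^sub>M count_space \<Omega>"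
    and law: "jump_law a M Z S"
    and XZ: "AE \<omega> in M. \<forall>k. (\<Sum>i<k. S i \<omega>) \<le> ennreal t \<and> ennreal t < (\<Sum>i\<le>k. S i \<omega>) \<longrightarrow> X t \<omega> = Z k \<omega>"
    by (rule jump_processE)
  interpret prob_space M by fact
  note [measurable] = S_meas[OF a M law] Z_meas[OF a M law]
  define B where "B k = {\<omega> \<in> space M. Z k \<omega> = b \<and> (\<Sum>i<k. S i \<omega>) \<le> ennreal t \<and> ennreal t < (\<Sum>i\<le>k. S i \<omega>)}" for k
  have [measurable]: "Measurable.pred M (\<lambda>\<omega>. Z k \<omega> = b)" for k
    using b by (auto intro!: pred_count_space_const1)
  have [measurable]: "Measurable.pred M (\<lambda>\<omega>. X t \<omega> = b)"
    using b by (auto intro!: pred_count_space_const1)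
  have B[measurable]: "B k \<in> events" for k unfolding B_def by measurable
  have disj: "disjoint_family B"
  proof -
    have "B k \<inter> B l = {}" if "k < l" for k l
    proof -
      have "(\<Sum>i\<le>k. S i \<omega>) \<le> (\<Sum>i<l. S i \<omega>)" for \<omega>
        using that by (intro sum_mono2) auto
      then have "\<omega> \<notin> B k \<or> \<omega> \<notin> B l" for \<omega>
        unfolding B_def mem_Collect_eq by (meson not_less order_trans)
      then show ?thesis by blast
    qed
    then show ?thesis unfolding disjoint_family_on_def by (metis inf_commute linorder_neqE_nat)
  qed
  have "(\<lambda>k. prob (B k)) sums prob (\<Union>k. B k)"
    using disj by (intro finite_measure_UNION) auto
  also have "(\<lambda>k. prob (B k)) = (\<lambda>k. occ k t a b)"
    unfolding B_def using prob_state_after_jumps[OF a M law b t] by simp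
  also have "prob (\<Union>k. B k) = prob {\<omega> \<in> space M. X t \<omega> = b}"
  proof (rule finite_measure_eq_AE)
    show "AE \<omega> in M. \<omega> \<in> (\<Union>k. B k) \<longleftrightarrow> \<omega> \<in> {\<omega> \<in> space M. X t \<omega> = b}"
      using XZ no_explosion[OF a M law t] AE_space
    proof eventually_elim
      case (elim \<omega>)
      then show ?case unfolding B_def UN_iff mem_Collect_eq by (metis UNIV_I)
    qed
  qed auto
  finally show ?thesis .
qed

text \<open>A scenario of positive probability: leave \<open>a\<close> by time 1, jump to
  \<open>b\<close>, and stay there for more than one unit of time. The law gives survival events
  only, so the first condition appears as the difference of \<open>A 0\<close> and
  \<open>A 1\<close>.\<close>

lemma trans_prob_pos:
  assumes a: "a \<in> \<Omega>" and b: "b \<in> \<Omega>" and X: "jump_process a M X" and jp: "0 < jp a b"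
  shows "0 < measure M {\<omega> \<in> space M. X 1 \<omega> = b}"
proof -
  from X zero_le_one obtain Z S where M: "prob_space M" and Xm[measurable]: "X 1 \<in> M \<rightarrow>\<^sub>M count_space \<Omega>"
    and law: "jump_law a M Z S"
    and XZ: "AE \<omega> in M. \<forall>k. (\<Sum>i<k. S i \<omega>) \<le> ennreal 1 \<and> ennreal 1 < (\<Sum>i\<le>k. S i \<omega>) \<longrightarrow> X 1 \<omega> = Z k \<omega>"
    by (rule jump_processE)
  interpret prob_space M by fact
  note [measurable] = S_meas[OF a M law] Z_meas[OF a M law]
  define A where "A s = {\<omega> \<in> space M. Z 0 \<omega> = a \<and> ennreal s < S 0 \<omega> \<and> Z (Suc 0) \<omega> = b \<and> 1 < S (Suc 0) \<omega>}" for s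
  have [measurable]: "Measurable.pred M (\<lambda>\<omega>. Z 0 \<omega> = a)" "Measurable.pred M (\<lambda>\<omega>. Z (Suc 0) \<omega> = b)"
    using a b by (auto intro!: pred_count_space_const1)
  have A: "A s \<in> events" for s
    unfolding A_def by measurable
  have pA: "prob (A s) = jp a b * (exp (- rate a * s) * exp (- rate b))" if s: "0 \<le> s" for s
  proof -
    let ?z = "\<lambda>i::nat. if i = 0 then a else b" and ?s = "\<lambda>i::nat. if i = 0 then s else 1"
    have "A s = {\<omega> \<in> space M. \<forall>i\<le>Suc 0. Z i \<omega> = ?z i \<and> ennreal (?s i) < S i \<omega>}"
      unfolding A_def by (rule Collect_cong) (simp add: le_Suc_eq all_conj_distrib conj_commute disj_imp)
    also have "prob \<dots> = path_prob a ?z (Suc 0) * (\<Prod>i\<le>Suc 0. exp (- rate (?z i) * ?s i))"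
      by (rule jump_lawD[OF law]) (use a b s in simp_all)
    finally show ?thesis by (simp add: path_prob_def)
  qed
  have [measurable]: "Measurable.pred M (\<lambda>\<omega>. X 1 \<omega> = b)"
    using b by (auto intro!: pred_count_space_const1)
  have "jp a b * (exp (- rate a * 1) * exp (- rate b)) < jp a b * (exp (- rate a * 0) * exp (- rate b))"
    using rate_pos[OF a] jp by simp
  then have "0 < prob (A 0) - prob (A 1)" by (simp add: pA)
  also have "prob (A 0) - prob (A 1) = prob (A 0 - A 1)"
  proof (rule finite_measure_Diff[symmetric])
    have "ennreal 0 < x" if "ennreal 1 < x" for x
      using zero_le that unfolding ennreal_0 by (rule le_less_trans)
    then show "A 1 \<subseteq> A 0" unfolding A_def by auto
  qed (rule A)+
  also have "\<dots> \<le> prob {\<omega> \<in> space M. X 1 \<omega> = b}"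
  proof (rule finite_measure_mono_AE)
    show "AE \<omega> in M. \<omega> \<in> A 0 - A 1 \<longrightarrow> \<omega> \<in> {\<omega> \<in> space M. X 1 \<omega> = b}"
      using XZ
    proof eventually_elim
      case (elim \<omega>)
      show ?case
      proof
        assume "\<omega> \<in> A 0 - A 1"
        then have \<omega>: "\<omega> \<in> space M" "Z (Suc 0) \<omega> = b" "1 < S (Suc 0) \<omega>" "S 0 \<omega> \<le> 1"
          by (auto simp: A_def not_less)
        have "1 < S 0 \<omega> + S (Suc 0) \<omega>"
          using \<omega>(3) by (rule less_le_trans) simp
        with \<omega> elim[rule_format, of "Suc 0"] show "\<omega> \<in> {\<omega> \<in> space M. X 1 \<omega> = b}"
          by simp
      qed
    qed
  qed auto
  finally show ?thesis .
qed

lemma trans_prob_sum: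
  assumes X: "jump_process a M X" and t: "0 \<le> t"
  shows "(\<Sum>b\<in>\<Omega>. measure M {\<omega> \<in> space M. X t \<omega> = b}) = 1"
proof -
  from X t have M: "prob_space M" and Xm[measurable]: "X t \<in> M \<rightarrow>\<^sub>M count_space \<Omega>"
    unfolding jump_process_def by auto
  interpret prob_space M by fact
  have "(\<Sum>b\<in>\<Omega>. prob {\<omega> \<in> space M. X t \<omega> = b}) = prob (\<Union>b\<in>\<Omega>. {\<omega> \<in> space M. X t \<omega> = b})"
    by (rule finite_measure_finite_Union[symmetric])
      (auto simp: finite_states disjoint_family_on_def intro!: pred_count_space_const1)
  also have "(\<Union>b\<in>\<Omega>. {\<omega> \<in> space M. X t \<omega> = b}) = space M"
    using measurable_space[OF Xm] by auto
  finally show ?thesis by (simp add: prob_space)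
qed

lemma stationary_unique:
  assumes proc: "\<And>a. a \<in> \<Omega> \<Longrightarrow> jump_process a (P a) X"
    and w1: "(\<Sum>a\<in>\<Omega>. w a) = 1"
    and conn: "\<And>a b. a \<in> \<Omega> \<Longrightarrow> b \<in> \<Omega> \<Longrightarrow> (a, b) \<in> {(a, b). a \<in> \<Omega> \<and> b \<in> \<Omega> \<and> 0 < jp a b}\<^sup>*"
  shows "stationary_distribution \<Omega> P X w"
    and "stationary_distribution \<Omega> P X \<mu> \<Longrightarrow> a \<in> \<Omega> \<Longrightarrow> \<mu> a = w a"
proof -
  have rev: "w a * trans_prob P X t a b = w b * trans_prob P X t b a"
    if "a \<in> \<Omega>" "b \<in> \<Omega>" "0 \<le> t" for a b t
  proof -
    have "(\<lambda>k. w a * occ k t a b) sums (w a * trans_prob P X t a b)"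
      unfolding trans_prob_def using that by (intro sums_mult trans_prob_sums proc)
    moreover have "(\<lambda>k. w b * occ k t b a) sums (w b * trans_prob P X t b a)"
      unfolding trans_prob_def using that by (intro sums_mult trans_prob_sums proc)
    ultimately show ?thesis using occ_reversible[of a _ t b] sums_unique2 by simp
  qed
  have one: "(\<Sum>b\<in>\<Omega>. trans_prob P X t a b) = 1" if "a \<in> \<Omega>" "0 \<le> t" for a t
    unfolding trans_prob_def using trans_prob_sum[OF proc] that by blast
  show "stationary_distribution \<Omega> P X w"
    unfolding stationary_distribution_def
  proof (intro conjI ballI allI impI w1)
    fix t b assume t: "0 \<le> (t::real)" and b: "b \<in> \<Omega>"
    have "(\<Sum>a\<in>\<Omega>. w a * trans_prob P X t a b) = (\<Sum>a\<in>\<Omega>. w b * trans_prob P X t b a)"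
      using b t by (intro sum.cong rev) auto
    also have "\<dots> = w b" using one[OF b t] by (simp add: sum_distrib_left[symmetric])
    finally show "(\<Sum>a\<in>\<Omega>. w a * trans_prob P X t a b) = w b" .
  qed (auto intro: less_imp_le w_pos)
  assume st: "stationary_distribution \<Omega> P X \<mu>" and a: "a \<in> \<Omega>"
  let ?p = "trans_prob P X 1"
  define f where "f a = \<mu> a / w a" for a
  have \<mu>f: "\<mu> a = w a * f a" if "a \<in> \<Omega>" for a using w_pos[OF that] by (simp add: f_def)
  have p0: "0 \<le> ?p a b" for a b by (simp add: trans_prob_def)
  \<comment> \<open>Reversibility turns invariance of \<open>\<mu>\<close> under the transition
    matrix acting on measures into invariance of the density \<open>f\<close> under its action on
    functions.\<close>
  have harm: "f b = (\<Sum>a\<in>\<Omega>. ?p b a * f a)" if b: "b \<in> \<Omega>" for b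
  proof -
    have "w b * f b = (\<Sum>a\<in>\<Omega>. \<mu> a * ?p a b)"
      using st b \<mu>f by (simp add: stationary_distribution_def)
    also have "\<dots> = (\<Sum>a\<in>\<Omega>. w b * (?p b a * f a))"
      using rev[of _ b 1] b by (intro sum.cong refl) (simp add: \<mu>f mult_ac)
    also have "\<dots> = w b * (\<Sum>a\<in>\<Omega>. ?p b a * f a)" by (simp add: sum_distrib_left)
    finally show ?thesis using w_pos[OF b] by simp
  qed
  define m where "m = Max (f ` \<Omega>)"
  have fm: "f a \<le> m" if "a \<in> \<Omega>" for a unfolding m_def using that finite_states by simp
  have "m \<in> f ` \<Omega>" unfolding m_def using a finite_states by (intro Max_in) auto
  then obtain c where c: "c \<in> \<Omega>" "f c = m" by auto
  \<comment> \<open>At a maximum the nonnegative gaps \<open>m - f c\<close> average to 0, so they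
    vanish wherever the transition probability is positive.\<close>
  have spread: "f b = m" if ab: "a \<in> \<Omega>" "b \<in> \<Omega>" "0 < jp a b" "f a = m" for a b
  proof -
    have "(\<Sum>c\<in>\<Omega>. ?p a c * (m - f c)) = m * (\<Sum>c\<in>\<Omega>. ?p a c) - (\<Sum>c\<in>\<Omega>. ?p a c * f c)"
      by (simp add: algebra_simps sum_subtractf sum_distrib_left)
    also have "\<dots> = 0" using one[of a 1] harm[OF ab(1)] ab by simp
    finally have "\<forall>c\<in>\<Omega>. ?p a c * (m - f c) = 0"
      using finite_states p0 fm by (subst (asm) sum_nonneg_eq_0_iff) auto
    moreover have "0 < ?p a b"
      unfolding trans_prob_def using ab by (intro trans_prob_pos[of a] proc) auto
    ultimately show ?thesis using ab by force
  qed
  have const: "f b = m" if "b \<in> \<Omega>" for b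
    using conn[OF c(1) that]
  proof (induction rule: rtrancl_induct)
    case (step y z)
    then show ?case using spread[of y z] by simp
  qed (rule c)
  have "1 = (\<Sum>a\<in>\<Omega>. \<mu> a)" using st by (simp add: stationary_distribution_def)
  also have "\<dots> = (\<Sum>a\<in>\<Omega>. w a * m)" by (intro sum.cong refl) (simp add: \<mu>f const)
  also have "\<dots> = m" using w1 by (simp add: sum_distrib_right[symmetric])
  finally show "\<mu> a = w a" using \<mu>f[OF a] const[OF a] by simp
qed

end


section \<open>Metropolis birth-death rates\<close>

text \<open>The source of detailed balance: weight times Metropolis rate is symmetric in the two
  weights.\<close>

lemma mult_min_ratio: "0 < (p::real) \<Longrightarrow> p * min (q / p) 1 = min q p"
  by (auto simp: min_def field_simps)

locale metropolis_birth_death =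
  fixes C :: "'c set" and B D :: "'c \<Rightarrow> 'c set \<Rightarrow> real" and w :: "'c set \<Rightarrow> real"
  assumes finite_C: "finite C"
    and w_pos: "N \<subseteq> C \<Longrightarrow> 0 < w N"
    and birth: "N \<subseteq> C \<Longrightarrow> u \<in> C - N \<Longrightarrow> B u N = min (w (insert u N) / w N) 1"
    and death: "N \<subseteq> C \<Longrightarrow> u \<in> C - N \<Longrightarrow> D u (insert u N) = min (w N / w (insert u N)) 1"
begin

lemma birth_pos: "N \<subseteq> C \<Longrightarrow> u \<in> C - N \<Longrightarrow> 0 < B u N"
  using birth[of N u] w_pos[of N] w_pos[of "insert u N"] by auto

lemma death_pos:
  assumes "N \<subseteq> C" "u \<in> N"
  shows "0 < D u N"
proof -
  \<comment> \<open>The hypothesis \<open>death\<close> speaks of states \<open>insert u N\<close>,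
    so \<open>u\<close> is taken out and put back.\<close>
  have N: "insert u (N - {u}) = N" using assms by blast
  have "N - {u} \<subseteq> C" "u \<in> C - (N - {u})" using assms by auto
  from death[OF this] w_pos[OF this(1)] w_pos[OF assms(1)] show ?thesis unfolding N by simp
qed

lemma birth_death_balance:
  assumes "N \<subseteq> C" "u \<in> C - N"
  shows "w N * B u N = w (insert u N) * D u (insert u N)"
proof -
  have "insert u N \<subseteq> C" using assms by auto
  then have "w N * B u N = min (w (insert u N)) (w N)" "w (insert u N) * D u (insert u N) = min (w N) (w (insert u N))"
    unfolding birth[OF assms] death[OF assms]
    using mult_min_ratio[OF w_pos] assms(1) by simp_all
  then show ?thesis by linarith
qed

lemma total_rate_pos:
  assumes "C \<noteq> {}" "N \<subseteq> C"
  shows "0 < total_rate C B D N"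
proof -
  have fin: "finite N" "finite (C - N)" using assms finite_C finite_subset by auto
  have nn: "0 \<le> (\<Sum>u\<in>C - N. B u N)" "0 \<le> (\<Sum>u\<in>N. D u N)"
    by (auto intro!: sum_nonneg less_imp_le[OF birth_pos[OF assms(2)]] less_imp_le[OF death_pos[OF assms(2)]])
  show ?thesis
  proof (cases "N = {}")
    case True
    then have "0 < (\<Sum>u\<in>C - N. B u N)" using assms fin by (intro sum_pos birth_pos) auto
    then show ?thesis using nn unfolding total_rate_def by linarith
  next
    case False
    then have "0 < (\<Sum>u\<in>N. D u N)" using assms fin by (intro sum_pos death_pos) auto
    then show ?thesis using nn unfolding total_rate_def by linarith
  qed
qed

text \<open>Multiplying by the total rate clears the denominator; what remains is the intensity of
  the jump, on which the following arguments rest.\<close>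

lemma rate_mult_jump_prob:
  assumes "C \<noteq> {}" "N \<subseteq> C"
  shows "total_rate C B D N * jump_prob C B D N N'
    = (\<Sum>u | u \<in> C - N \<and> N' = insert u N. B u N) + (\<Sum>u | u \<in> N \<and> N' = N - {u}. D u N)"
  using total_rate_pos[OF assms] by (simp add: jump_prob_def)

lemma jump_prob_pos:
  assumes N: "N \<subseteq> C" and u: "u \<in> C - N"
  shows "0 < jump_prob C B D N (insert u N)" "0 < jump_prob C B D (insert u N) N"
proof -
  have C: "C \<noteq> {}" using u by auto
  \<comment> \<open>The enlarged model arises by exactly one birth and by no death;
    \<open>e3\<close> and \<open>e4\<close> are the mirror image.\<close>
  have e1: "{v. v \<in> C - N \<and> insert u N = insert v N} = {u}" using u by auto
  have e2: "{v. v \<in> N \<and> insert u N = N - {v}} = {}" using u by auto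
  have up: "total_rate C B D N * jump_prob C B D N (insert u N) = B u N"
    unfolding rate_mult_jump_prob[OF C N] e1 e2 by simp
  then show "0 < jump_prob C B D N (insert u N)"
    using total_rate_pos[OF C N] birth_pos[OF N u] by (simp add: zero_less_mult_iff flip: up)
  have N': "insert u N \<subseteq> C" using N u by auto
  have e3: "{v. v \<in> C - insert u N \<and> N = insert v (insert u N)} = {}" using u by auto
  have e4: "{v. v \<in> insert u N \<and> N = insert u N - {v}} = {u}" using u by auto
  have down: "total_rate C B D (insert u N) * jump_prob C B D (insert u N) N = D u (insert u N)"
    unfolding rate_mult_jump_prob[OF C N'] e3 e4 by simp
  then show "0 < jump_prob C B D (insert u N) N"
    using total_rate_pos[OF C N'] death_pos[OF N', of u] by (simp add: zero_less_mult_iff flip: down)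
qed

lemma reversible:
  assumes C: "C \<noteq> {}"
  shows "reversible_jump_chain (Pow C) (total_rate C B D) (jump_prob C B D) w"
proof
  let ?r = "total_rate C B D" and ?j = "jump_prob C B D"
  show "finite (Pow C)" using finite_C by simp
  show "0 < ?r N" if "N \<in> Pow C" for N using total_rate_pos[OF C] that by simp
  show "0 < w N" if "N \<in> Pow C" for N using w_pos that by simp
  show "0 \<le> ?j N N'" if "N \<in> Pow C" "N' \<in> Pow C" for N N'
  proof -
    have N: "N \<subseteq> C" using that by simp
    have "0 \<le> ?r N * ?j N N'"
      unfolding rate_mult_jump_prob[OF C N]
      using birth_pos[OF N] death_pos[OF N]
      by (intro add_nonneg_nonneg sum_nonneg) (simp_all add: less_imp_le)
    then show ?thesis using total_rate_pos[OF C N] by (simp add: zero_le_mult_iff)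
  qed
  show "(\<Sum>N'\<in>Pow C. ?j N N') = 1" if "N \<in> Pow C" for N
  proof -
    have N: "N \<subseteq> C" using that by simp
    then have fin: "finite N" "finite (C - N)" using finite_C finite_subset by auto
    \<comment> \<open>Each candidate leads to exactly one new model, so exchanging the sums leaves
      one term per candidate.\<close>
    have 1: "(\<Sum>N'\<in>Pow C. \<Sum>u | u \<in> C - N \<and> N' = insert u N. B u N) = (\<Sum>u\<in>C - N. B u N)"
    proof -
      have "(\<Sum>N'\<in>Pow C. \<Sum>u | u \<in> C - N \<and> N' = insert u N. B u N)
          = (\<Sum>u\<in>C - N. \<Sum>N' | N' \<in> Pow C \<and> N' = insert u N. B u N)"
        by (rule sum.swap_restrict) (use fin finite_C in auto)
      also have "\<dots> = (\<Sum>u\<in>C - N. B u N)"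
      proof (rule sum.cong)
        fix u assume "u \<in> C - N"
        then have "{N'. N' \<in> Pow C \<and> N' = insert u N} = {insert u N}" using N by auto
        then show "(\<Sum>N' | N' \<in> Pow C \<and> N' = insert u N. B u N) = B u N" by simp
      qed simp
      finally show ?thesis .
    qed
    have 2: "(\<Sum>N'\<in>Pow C. \<Sum>u | u \<in> N \<and> N' = N - {u}. D u N) = (\<Sum>u\<in>N. D u N)"
    proof -
      have "(\<Sum>N'\<in>Pow C. \<Sum>u | u \<in> N \<and> N' = N - {u}. D u N)
          = (\<Sum>u\<in>N. \<Sum>N' | N' \<in> Pow C \<and> N' = N - {u}. D u N)"
        by (rule sum.swap_restrict) (use fin finite_C in auto)
      also have "\<dots> = (\<Sum>u\<in>N. D u N)"
      proof (rule sum.cong)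
        fix u assume "u \<in> N"
        then have "{N'. N' \<in> Pow C \<and> N' = N - {u}} = {N - {u}}" using N by auto
        then show "(\<Sum>N' | N' \<in> Pow C \<and> N' = N - {u}. D u N) = D u N" by simp
      qed simp
      finally show ?thesis .
    qed
    have "?r N * (\<Sum>N'\<in>Pow C. ?j N N') = ?r N"
      unfolding sum_distrib_left rate_mult_jump_prob[OF C N] sum.distrib 1 2 by (simp add: total_rate_def)
    then show ?thesis using total_rate_pos[OF C N] by simp
  qed
  show "w N * ?r N * ?j N N' = w N' * ?r N' * ?j N' N" if NN: "N \<in> Pow C" "N' \<in> Pow C" for N N'
  proof -
    have *: "w K * (\<Sum>u | u \<in> C - K \<and> L = insert u K. B u K) = w L * (\<Sum>u | u \<in> L \<and> K = L - {u}. D u L)"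
      if KL: "K \<subseteq> C" "L \<subseteq> C" for K L
    proof -
      \<comment> \<open>The births leading from \<open>K\<close> to \<open>L\<close> are the deaths
        leading from \<open>L\<close> to \<open>K\<close>.\<close>
      have "{u. u \<in> L \<and> K = L - {u}} = {u. u \<in> C - K \<and> L = insert u K}" using KL by auto
      then show ?thesis
        unfolding sum_distrib_left using KL by (intro sum.cong) (auto simp: birth_death_balance)
    qed
    have N: "N \<subseteq> C" "N' \<subseteq> C" using NN by auto
    show ?thesis
      unfolding mult.assoc rate_mult_jump_prob[OF C N(1)] rate_mult_jump_prob[OF C N(2)] distrib_left
      using *[OF N] *[OF N(2,1)] by linarith
  qed
qed

text \<open>All models communicate through the empty one, by adding or deleting one candidate at a
  time.\<close>

lemma connected:
  defines "E \<equiv> {(a, b). a \<in> Pow C \<and> b \<in> Pow C \<and> 0 < jump_prob C B D a b}"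
  assumes "N \<in> Pow C" "N' \<in> Pow C"
  shows "(N, N') \<in> E\<^sup>*"
proof -
  have "({}, K) \<in> E\<^sup>* \<and> (K, {}) \<in> E\<^sup>*" if "K \<subseteq> C" for K
    using finite_subset[OF that finite_C] that
  proof (induction K rule: finite_induct)
    case (insert u K)
    then have "(K, insert u K) \<in> E" "(insert u K, K) \<in> E"
      using jump_prob_pos[of K u] by (auto simp: E_def)
    with insert show ?case
      by (meson insert_subset rtrancl.rtrancl_into_rtrancl converse_rtrancl_into_rtrancl)
  qed simp
  then show ?thesis using assms(2,3) by (meson PowD rtrancl_trans)
qed

lemma stationary:
  assumes proc: "\<And>N. N \<subseteq> C \<Longrightarrow> birth_death_process C B D N (P N) X"
    and w1: "(\<Sum>N\<in>Pow C. w N) = 1"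
  shows "stationary_distribution (Pow C) P X w"
    and "stationary_distribution (Pow C) P X \<mu> \<Longrightarrow> N \<subseteq> C \<Longrightarrow> \<mu> N = w N"
proof -
  have "stationary_distribution (Pow C) P X w \<and>
    (\<forall>\<mu>. stationary_distribution (Pow C) P X \<mu> \<longrightarrow> (\<forall>N\<in>Pow C. \<mu> N = w N))"
  proof (cases "C = {}")
    \<comment> \<open>Without candidates the only state is absorbing and its total rate is 0, so the
      locale of reversible chains does not apply; the process is constant.\<close>
    case True
    have "trans_prob P X t {} {} = 1" if "0 \<le> t" for t
    proof -
      have "birth_death_process C B D {} (P {}) X" by (rule proc) simp
      then have M: "prob_space (P {})" and X: "X t \<in> P {} \<rightarrow>\<^sub>M count_space {{}}"
        using that unfolding birth_death_process_def True Pow_empty by blast+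
      interpret prob_space "P {}" by (rule M)
      have "{\<omega> \<in> space (P {}). X t \<omega> = {}} = space (P {})"
        using measurable_space[OF X] by auto
      then show ?thesis by (simp add: trans_prob_def prob_space)
    qed
    then show ?thesis using w1 by (simp add: True stationary_distribution_def)
  next
    case False
    interpret reversible_jump_chain "Pow C" "total_rate C B D" "jump_prob C B D" w
      using False by (rule reversible)
    have "jump_process N (P N) X" if "N \<in> Pow C" for N
      using proc[of N] that
      unfolding birth_death_process_def jump_process_def jump_hold_def jump_law_def by simp
    note unique = stationary_unique[OF this w1 connected]
    show ?thesis
    proof (intro conjI allI impI ballI)
      show "stationary_distribution (Pow C) P X w" by (rule unique(1))
      show "\<mu> N = w N" if "stationary_distribution (Pow C) P X \<mu>" "N \<in> Pow C" for \<mu> N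
        using that by (intro unique(2))
    qed
  qed
  then show "stationary_distribution (Pow C) P X w"
    and "stationary_distribution (Pow C) P X \<mu> \<Longrightarrow> N \<subseteq> C \<Longrightarrow> \<mu> N = w N" by auto
qed

end


section \<open>Positivity of the posterior\<close>

lemma cond_likelihood_pos: "0 < cond_likelihood H v n x y N \<theta>"
  unfolding cond_likelihood_def by (intro prod_pos) (auto intro!: divide_pos_pos add_pos_pos)

lemma cond_likelihood_le_1: "cond_likelihood H v n x y N \<theta> \<le> 1"
  unfolding cond_likelihood_def
proof (intro prod_le_1 conjI)
  fix m
  show "exp (of_bool (y m v) * predictor H (x m) (y m) N \<theta>) / (1 + exp (predictor H (x m) (y m) N \<theta>)) \<le> 1"
    by (cases "y m v") (auto simp: divide_le_eq add_pos_pos)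
  show "0 \<le> exp (of_bool (y m v) * predictor H (x m) (y m) N \<theta>) / (1 + exp (predictor H (x m) (y m) N \<theta>))"
    by (intro divide_nonneg_nonneg) (auto intro: add_nonneg_nonneg)
qed

lemma measurable_cond_likelihood:
  assumes "sets M = sets (PiM (params H N) (\<lambda>_. borel))"
  shows "cond_likelihood H v n x y N \<in> borel_measurable M"
proof -
  have c: "(\<lambda>\<theta>. \<theta> p) \<in> borel_measurable (PiM (params H N) (\<lambda>_. borel :: real measure))" if "p \<in> params H N" for p
    by (rule measurable_component_singleton) (rule that)
  \<comment> \<open>The predictor reads only coordinates of the product space on which the prior
    lives.\<close>
  have "Node h \<in> params H N" "u \<in> nbrs N h \<Longrightarrow> Edge u h \<in> params H N" if "h \<in> {0..H}" for h u
    using that by (auto simp: params_def)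
  then have p[measurable]: "predictor H x' y' N \<in> borel_measurable (PiM (params H N) (\<lambda>_. borel))" for x' y'
    unfolding predictor_def[abs_def]
    by (intro borel_measurable_sum borel_measurable_add borel_measurable_times borel_measurable_const c) auto
  have "cond_likelihood H v n x y N \<in> borel_measurable (PiM (params H N) (\<lambda>_. borel))"
    unfolding cond_likelihood_def[abs_def] by measurable
  then show ?thesis using measurable_cong_sets[OF assms refl] by blast
qed

text \<open>The likelihood is measurable with values in (0,1], hence integrable, and a strictly
  positive integrand has a positive mean. Integrability matters because the integral of a
  non-integrable function is 0 by default.\<close>

lemma marginal_likelihood_pos:
  assumes "param_prior H N (\<rho> N)"
  shows "0 < marginal_likelihood H v n x y \<rho> N"
proof -
  interpret prob_space "\<rho> N" using assms by (simp add: param_prior_def)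
  have "cond_likelihood H v n x y N \<in> borel_measurable (\<rho> N)"
    using assms by (intro measurable_cond_likelihood) (simp add: param_prior_def)
  then have "integrable (\<rho> N) (cond_likelihood H v n x y N)"
    by (intro integrable_const_bound[where B = 1])
      (auto simp: cond_likelihood_le_1 less_imp_le[OF cond_likelihood_pos])
  then show ?thesis
    unfolding marginal_likelihood_def by (rule expectation_greater) (simp add: cond_likelihood_pos)
qed

text \<open>Full support of the prior makes every term of the normalising sum positive, and there is
  at least one model.\<close>

lemma
  assumes "finite V" and "set_pmf \<pi> = models V H v"
    and "\<And>N. N \<in> models V H v \<Longrightarrow> param_prior H N (\<rho> N)"
  shows posterior_pos: "N \<in> models V H v \<Longrightarrow> 0 < posterior V H v n x y \<rho> \<pi> N"
    and sum_posterior: "(\<Sum>N\<in>models V H v. posterior V H v n x y \<rho> \<pi> N) = 1"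
proof -
  let ?f = "\<lambda>N. marginal_likelihood H v n x y \<rho> N * pmf \<pi> N"
  have pos: "0 < ?f N" if "N \<in> models V H v" for N
    using that assms by (intro mult_pos_pos marginal_likelihood_pos) (auto simp: pmf_positive)
  have "finite (models V H v)" "models V H v \<noteq> {}"
    using assms(1) by (auto simp: models_def candidates_def)
  then have total: "0 < (\<Sum>N\<in>models V H v. ?f N)" by (intro sum_pos pos)
  show "0 < posterior V H v n x y \<rho> \<pi> N" if "N \<in> models V H v"
    unfolding posterior_def using pos[OF that] total by (rule divide_pos_pos)
  show "(\<Sum>N\<in>models V H v. posterior V H v n x y \<rho> \<pi> N) = 1"
    unfolding posterior_def sum_divide_distrib[symmetric] using total by simp
qed

text \<open>Neighbourhood models are the subsets of the candidate set and the posterior is a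
  positive weight on them, so the Metropolis results apply. The second conjunct expresses that it is
  the only stationary distribution.\<close>

theorem theorem2:
  fixes V :: "'v set" and v :: 'v and H n :: nat
    and x :: "nat \<Rightarrow> nat \<Rightarrow> real" and y :: "nat \<Rightarrow> 'v \<Rightarrow> bool"
    and \<pi> :: "('v \<times> nat) set pmf"
    and \<rho> :: "('v \<times> nat) set \<Rightarrow> ('v param \<Rightarrow> real) measure"
    and B D :: "('v \<times> nat) \<Rightarrow> ('v \<times> nat) set \<Rightarrow> real"
    and P :: "('v \<times> nat) set \<Rightarrow> 'w measure"
    and X :: "real \<Rightarrow> 'w \<Rightarrow> ('v \<times> nat) set"
    and post :: "('v \<times> nat) set \<Rightarrow> real"
  assumes "finite V" and "v \<in> V" and "H \<ge> 1"
    and "\<And>m. m \<in> {1..n} \<Longrightarrow> x m 0 = 1"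
    and "set_pmf \<pi> = models V H v"
    and "\<And>N. N \<in> models V H v \<Longrightarrow> param_prior H N (\<rho> N)"
  defines "post \<equiv> posterior V H v n x y \<rho> \<pi>"
  assumes birth: "\<And>N u. N \<in> models V H v \<Longrightarrow> u \<in> candidates V H v - N \<Longrightarrow>
        B u N = min (post (insert u N) / post N) 1"
    and death: "\<And>N u. N \<in> models V H v \<Longrightarrow> u \<in> candidates V H v - N \<Longrightarrow>
        D u (insert u N) = min (post N / post (insert u N)) 1"
    and process: "\<And>N. N \<in> models V H v \<Longrightarrow>
        birth_death_process (candidates V H v) B D N (P N) X"
  shows "stationary_distribution (models V H v) P X post \<and>
    (\<forall>\<mu>. stationary_distribution (models V H v) P X \<mu> \<longrightarrow>
       (\<forall>N\<in>models V H v. \<mu> N = post N))"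
proof -
  have models: "models V H v = Pow (candidates V H v)" by (simp add: models_def)
  note pos = posterior_pos[OF assms(1,5,6), where n = n and x = x and y = y, folded post_def]
  note sum1 = sum_posterior[OF assms(1,5,6), where n = n and x = x and y = y, folded post_def]
  interpret metropolis_birth_death "candidates V H v" B D post
    using assms(1) pos birth death by unfold_locales (auto simp: models candidates_def)
  show ?thesis
    unfolding models
  proof (intro conjI allI impI ballI)
    show "stationary_distribution (Pow (candidates V H v)) P X post"
      by (rule stationary(1)) (use process sum1 in \<open>simp_all add: models\<close>)
    show "\<mu> N = post N"
      if "stationary_distribution (Pow (candidates V H v)) P X \<mu>" "N \<in> Pow (candidates V H v)" for \<mu> N
      by (rule stationary(2)[where P = P and X = X]) (use process sum1 that in \<open>simp_all add: models\<close>)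
  qed
qed

end
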